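(* Let $h\in C[0,1]$, $x\in[0,1]$, and let $n\ge10$ be an integer. Then $$\lim_{\varrho\to\infty}\bigl|A_n^{\varrho}(\Psi h;x)-(-A_{\varrho}^{-1})(\Psi h;x)\bigr|=\bigl|A_n^{\infty}(\Psi h;x)-(-A_\infty^{-1})(\Psi h;x)\bigr|$$ and $$\bigl|A_n^{\infty}(\Psi h;x)-(-A_\infty^{-1})(\Psi h;x)\bigr|\le 3\Psi(x)\left[\frac1{\sqrt n}\,\omega_1\!\left(h;\frac1{\sqrt n}\right)+\omega_2\!\left(h;\frac1{\sqrt n}\right)\right].$$
   Context: $C[0,1]$ is the space of continuous real-valued functions on $[0,1]$ with sup norm $\|\cdot\|_\infty$, and $\Psi(x):=x(1-x)$. For $\varrho>0$ and an integer $n\ge 1$, the operator $U_n^{\varrho}$ on $C[0,1]$ is defined by $$U_n^{\varrho}(f,x)=f(0)(1-x)^n+f(1)x^n+\sum_{k=1}^{n-1}\left(\int_0^1\frac{t^{k\varrho-1}(1-t)^{(n-k)\varrho-1}}{B(k\varrho,(n-k)\varrho)}f(t)\,dt\right)p_{n,k}(x),$$ where $p_{n,k}(x)=\binom nk x^k(1-x)^{n-k}$ and $B(\cdot,\cdot)$ is Euler's Beta function. $B_n$ denotes the classical Bernstein operator $B_n(f,x)=\sum_{k=0}^n f(k/n)p_{n,k}(x)$. $C_0[0,1]:=\{f : f(x)=x(1-x)h(x),\ h\in C[0,1]\}$, with norm $\|f\|_0:=\|h\|_\infty$ for $f(x)=x(1-x)h(x)$; this is a Banach space. $U_n^{\varrho}$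 and $B_n$ map $C_0[0,1]$ into itself with operator norms (with respect to $\|\cdot\|_0$) strictly less than $1$, so one may define on $C_0[0,1]$ $$A_n^{\varrho}:=\frac{\varrho}{n\varrho+1}\sum_{k=0}^{\infty}(U_n^{\varrho})^k,\qquad A_n^{\infty}:=\frac1n\sum_{k=0}^\infty (B_n)^k,\qquad n\ge1,$$ the series converging in operator norm on $(C_0[0,1],\|\cdot\|_0)$. For $h\in C[0,1]$ put $$F_\infty(h;x):=(1-x)\int_0^x t\,h(t)\,dt+x\int_x^1(1-t)h(t)\,dt .$$ $A_\varrho:\{y\in C^2[0,1] : y(0)=y(1)=0\}\to C_0[0,1]$ is the (bijective) operator $A_\varrho y(x):=\frac{\varrho+1}{2\varrho}x(1-x)y''(x)$, and its inverse satisfies $-A_\varrho^{-1}(\Psi h;x)=\frac{2\varrho}{\varrho+1}F_\infty(h;x)$. In the limiting case one sets, by definition, $-A_\infty^{-1}(\Psi h;x):=2F_\infty(h;x)$. $\omega_1$ and $\omega_2$ are the usual first and second order moduli of continuity on $[0,1]$: $\omega_1(h;\delta)=\sup\{|h(x)-h(y)| : x,y\in[0,1],\ |x-y|\le\delta\}$ and $\omega_2(h;\delta)=\sup\{|h(x+s)-2h(x)+h(x-s)| : 0\le s\le\delta,\ x\pm s\in[0,1]\}$. *)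

theory Defs
  imports "HOL-Analysis.Analysis"
begin

(* Functions on [0,1] are represented by functions of type real => real of which only the
   values on {0..1} matter.  Consequently, objects that are unique in the mathematics are unique
   here only up to their values on {0..1}, and are selected with SOME. *)

definition Psi :: "real \<Rightarrow> real" where
  "Psi x = x * (1 - x)"

definition sup_norm :: "(real \<Rightarrow> real) \<Rightarrow> real" where
  "sup_norm h = (SUP x\<in>{0..1}. \<bar>h x\<bar>)"

definition modulus1 :: "(real \<Rightarrow> real) \<Rightarrow> real \<Rightarrow> real" where
  "modulus1 h \<delta> = Sup {\<bar>h x - h y\<bar> | x y. x \<in> {0..1} \<and> y \<in> {0..1} \<and> \<bar>x - y\<bar> \<le> \<delta>}"

definition modulus2 :: "(real \<Rightarrow> real) \<Rightarrow> real \<Rightarrow> real" where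
  "modulus2 h \<delta> = Sup {\<bar>h (x + s) - 2 * h x + h (x - s)\<bar> | x s.
     0 \<le> s \<and> s \<le> \<delta> \<and> x + s \<in> {0..1} \<and> x - s \<in> {0..1}}"

definition bernstein_op :: "nat \<Rightarrow> (real \<Rightarrow> real) \<Rightarrow> real \<Rightarrow> real" where
  "bernstein_op n f x = (\<Sum>k=0..n. f (real k / real n) * Bernstein n k x)"

definition U_op :: "nat \<Rightarrow> real \<Rightarrow> (real \<Rightarrow> real) \<Rightarrow> real \<Rightarrow> real" where
  "U_op n \<rho> f x = f 0 * (1 - x) ^ n + f 1 * x ^ n +
     (\<Sum>k=1..n - 1.
        integral {0..1} (\<lambda>t. t powr (real k * \<rho> - 1) * (1 - t) powr (real (n - k) * \<rho> - 1)
                               / Beta (real k * \<rho>) (real (n - k) * \<rho>) * f t)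
        * Bernstein n k x)"

definition C0 :: "(real \<Rightarrow> real) set" where
  "C0 = {f. \<exists>h. continuous_on {0..1} h \<and> (\<forall>x\<in>{0..1}. f x = Psi x * h x)}"

definition Psi_quot :: "(real \<Rightarrow> real) \<Rightarrow> real \<Rightarrow> real" where
  "Psi_quot f = (SOME h. continuous_on {0..1} h \<and> (\<forall>x\<in>{0..1}. f x = Psi x * h x))"

definition norm0 :: "(real \<Rightarrow> real) \<Rightarrow> real" where
  "norm0 f = sup_norm (Psi_quot f)"

definition linear_on_C0 :: "((real \<Rightarrow> real) \<Rightarrow> real \<Rightarrow> real) \<Rightarrow> bool" where
  "linear_on_C0 T \<longleftrightarrow> (\<forall>f\<in>C0. T f \<in> C0) \<and>
     (\<forall>f\<in>C0. \<forall>g\<in>C0. \<forall>a b. \<forall>x\<in>{0..1}. T (\<lambda>t. a * f t + b * g t) x = a * T f x + b * T g x)"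

(* The value is taken in ennreal so that the supremum is meaningful for unbounded operators. *)
definition opnorm0 :: "((real \<Rightarrow> real) \<Rightarrow> real \<Rightarrow> real) \<Rightarrow> ennreal" where
  "opnorm0 T = (SUP f\<in>{f \<in> C0. norm0 f \<le> 1}. ennreal (norm0 (T f)))"

definition power_series_sums ::
    "((real \<Rightarrow> real) \<Rightarrow> real \<Rightarrow> real) \<Rightarrow> ((real \<Rightarrow> real) \<Rightarrow> real \<Rightarrow> real) \<Rightarrow> bool" where
  "power_series_sums T S \<longleftrightarrow> linear_on_C0 S \<and>
     (\<lambda>N. opnorm0 (\<lambda>f x. S f x - (\<Sum>k<N. (T ^^ k) f x))) \<longlonglongrightarrow> 0"

definition power_series_op ::
    "((real \<Rightarrow> real) \<Rightarrow> real \<Rightarrow> real) \<Rightarrow> (real \<Rightarrow> real) \<Rightarrow> real \<Rightarrow> real" where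
  "power_series_op T = (SOME S. power_series_sums T S)"

definition A_series :: "nat \<Rightarrow> real \<Rightarrow> (real \<Rightarrow> real) \<Rightarrow> real \<Rightarrow> real" where
  "A_series n \<rho> f x = \<rho> / (real n * \<rho> + 1) * power_series_op (U_op n \<rho>) f x"

definition A_series_inf :: "nat \<Rightarrow> (real \<Rightarrow> real) \<Rightarrow> real \<Rightarrow> real" where
  "A_series_inf n f x = 1 / real n * power_series_op (bernstein_op n) f x"

(* Derivative relative to [0,1], hence one-sided at the end points. *)
definition deriv01 :: "(real \<Rightarrow> real) \<Rightarrow> real \<Rightarrow> real" where
  "deriv01 y x = vector_derivative y (at x within {0..1})"

definition C2_zero :: "(real \<Rightarrow> real) set" where
  "C2_zero = {y. y differentiable_on {0..1} \<and> deriv01 y differentiable_on {0..1} \<and>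
     continuous_on {0..1} (deriv01 (deriv01 y)) \<and> y 0 = 0 \<and> y 1 = 0}"

definition A_diff :: "real \<Rightarrow> (real \<Rightarrow> real) \<Rightarrow> real \<Rightarrow> real" where
  "A_diff \<rho> y x = (\<rho> + 1) / (2 * \<rho>) * (x * (1 - x)) * deriv01 (deriv01 y) x"

definition A_diff_inv :: "real \<Rightarrow> (real \<Rightarrow> real) \<Rightarrow> real \<Rightarrow> real" where
  "A_diff_inv \<rho> f = (SOME y. y \<in> C2_zero \<and> (\<forall>x\<in>{0..1}. A_diff \<rho> y x = f x))"

definition F_inf :: "(real \<Rightarrow> real) \<Rightarrow> real \<Rightarrow> real" where
  "F_inf h x = (1 - x) * integral {0..x} (\<lambda>t. t * h t) + x * integral {x..1} (\<lambda>t. (1 - t) * h t)"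

definition A_diff_inv_inf :: "(real \<Rightarrow> real) \<Rightarrow> real \<Rightarrow> real" where
  "A_diff_inv_inf f x = - (2 * F_inf (Psi_quot f) x)"

end

(* U_n^rho and B_n fix the endpoints and contract C_0[0,1], since they map Psi to a multiple of Psi
   with factor below 1; hence g = sum_k T^k f is the unique solution of g = f + T g, and a residual
   bounded by r Psi costs at most r / (1 - gamma) Psi in g.  As rho tends to infinity the Beta
   functionals concentrate at k/n, so U_n^rho G - B_n G tends to 0 for the limit solution G, while
   1 / (1 - gamma) <= n stays bounded; this gives the limit.

   For the estimate let y = 2 F_inf h, so y'' = -2 h.  The error A_n^inf (Psi h) - y has as residual
   the Voronovskaya remainder B_n y - y - Psi y'' / (2 n).  Instead of smoothing h globally, one
   subtracts from h near x a line with slope a difference quotient of step 1 / sqrt n; what is left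
   grows at most quadratically with factor omega_2, and two integrations together with the central
   Bernstein moments up to order 4 finish the proof. *)
theory Submission
  imports Defs "HOL-Real_Asymp.Real_Asymp"
begin

section \<open>Neumann series of contractions of C0\<close>

text \<open>For n >= 2 the operators \<open>U_op n \<rho>\<close> do not converge to
  \<open>bernstein_op n\<close> in operator norm: a narrow spike at a node is seen by point
  evaluation but hardly by a Beta mean. Hence the two are compared only on the single function G.

  The factor 1 / sqrt n at omega_1 rests on a cancellation. With d = 1 / sqrt n the slope m of the
  subtracted line may be as large as omega_1 / d. It enters through m / 3 times the signed third
  central moment Psi (1 - 2 x) / n^2, hence with at most (1/3) d omega_1 Psi / n, because 1 / d = n
  d. The absolute third moment is of order n^(-3/2) at a fixed interior x and would leave omega_1
  without the factor d. The second and fourth moments give omega_2 the coefficient 2 + (2/3) (3/4) =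
  5/2. Both 1/3 and 5/2 are below 3.

  Estimates are kept as pointwise bounds by c Psi: these yield the factor Psi(x) of the claim
  directly and avoid the quotients chosen by SOME inside \<open>norm0\<close>.\<close>

lemma Psi_nonneg: "x \<in> {0..1} \<Longrightarrow> 0 \<le> Psi x"
  by (simp add: Psi_def)

lemma Psi_pos: "x \<in> {0<..<1} \<Longrightarrow> 0 < Psi x"
  by (simp add: Psi_def)

lemma Psi_le_quarter: "Psi x \<le> 1 / 4"
  using zero_le_power2[of "x - 1/2"] by (simp add: Psi_def power2_eq_square algebra_simps)

lemma Psi_0 [simp]: "Psi 0 = 0" and Psi_1 [simp]: "Psi 1 = 0"
  by (simp_all add: Psi_def)

lemma continuous_on_Psi [continuous_intros]: "continuous_on S Psi"
  unfolding Psi_def[abs_def] by (intro continuous_intros)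

lemma continuous_bound_from_interior:
  fixes g :: "real \<Rightarrow> real"
  assumes "continuous_on {0..1} g" and "\<And>x. x \<in> {0<..<1} \<Longrightarrow> \<bar>g x\<bar> \<le> c" and "x \<in> {0..1}"
  shows "\<bar>g x\<bar> \<le> c"
proof -
  have cl: "closure {0<..<1::real} = {0..1}"
    by (simp add: closure_greaterThanLessThan)
  have "norm (g x) \<le> c"
    using continuous_on_closure_norm_le[of "{0<..<1}" g c x] assms cl by auto
  then show ?thesis by simp
qed

text \<open>Division by \<open>Psi\<close> is possible only in the open interval; continuity of
  \<open>g\<close> carries the bound to the zeros 0 and 1 of \<open>Psi\<close>.\<close>

lemma Psi_mult_bound_cancel:
  assumes "continuous_on {0..1} g" and "\<And>x. x \<in> {0..1} \<Longrightarrow> \<bar>Psi x * g x\<bar> \<le> c * Psi x"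
    and "x \<in> {0..1}"
  shows "\<bar>g x\<bar> \<le> c"
proof (rule continuous_bound_from_interior[OF assms(1) _ assms(3)])
  fix t :: real assume t: "t \<in> {0<..<1}"
  have "Psi t * \<bar>g t\<bar> \<le> Psi t * c"
    using assms(2)[of t] t Psi_nonneg[of t] by (simp add: abs_mult mult.commute)
  then show "\<bar>g t\<bar> \<le> c"
    using Psi_pos[OF t] by simp
qed

lemma Psi_mult_cancel:
  assumes "continuous_on {0..1} g" "continuous_on {0..1} h"
    and "\<And>x. x \<in> {0..1} \<Longrightarrow> Psi x * g x = Psi x * h x" and "x \<in> {0..1}"
  shows "g x = h x"
proof -
  have "\<bar>g x - h x\<bar> \<le> 0"
    by (rule Psi_mult_bound_cancel[where g = "\<lambda>x. g x - h x"])
      (use assms in \<open>auto intro!: continuous_intros simp: algebra_simps\<close>)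
  then show ?thesis by simp
qed

lemma C0I:
  assumes "continuous_on {0..1} h" "\<And>x. x \<in> {0..1} \<Longrightarrow> f x = Psi x * h x"
  shows "f \<in> C0"
  using assms by (auto simp: C0_def)

lemma Psi_quot_props:
  assumes "f \<in> C0"
  shows "continuous_on {0..1} (Psi_quot f)" and "x \<in> {0..1} \<Longrightarrow> f x = Psi x * Psi_quot f x"
proof -
  have "\<exists>h. continuous_on {0..1} h \<and> (\<forall>x\<in>{0..1}. f x = Psi x * h x)"
    using assms by (simp add: C0_def)
  from someI_ex[OF this]
  show "continuous_on {0..1} (Psi_quot f)" and "x \<in> {0..1} \<Longrightarrow> f x = Psi x * Psi_quot f x"
    unfolding Psi_quot_def by blast+
qed

text \<open>Makes the choice in \<open>Psi_quot\<close> harmless: any two continuous quotients agree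
  on [0,1].\<close>

lemma Psi_quot_eq:
  assumes "continuous_on {0..1} h" "\<And>x. x \<in> {0..1} \<Longrightarrow> f x = Psi x * h x" "x \<in> {0..1}"
  shows "Psi_quot f x = h x"
  using Psi_mult_cancel[OF Psi_quot_props(1)[OF C0I[OF assms(1,2)]] assms(1) _ assms(3)]
    Psi_quot_props(2)[OF C0I[OF assms(1,2)]] assms(2) by force

lemma C0_continuous: "f \<in> C0 \<Longrightarrow> continuous_on {0..1} f"
  using Psi_quot_props[of f]
  by (subst continuous_on_cong[OF refl, where g = "\<lambda>x. Psi x * Psi_quot f x"])
    (auto intro!: continuous_intros)

lemma C0_endpoints: "f \<in> C0 \<Longrightarrow> f 0 = 0 \<and> f 1 = 0"
  using Psi_quot_props(2)[of f 0] Psi_quot_props(2)[of f 1] by simp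

lemma C0_cong: "f \<in> C0 \<Longrightarrow> (\<And>x. x \<in> {0..1} \<Longrightarrow> g x = f x) \<Longrightarrow> g \<in> C0"
  using Psi_quot_props[of f] C0I[of "Psi_quot f" g] by auto

lemma C0_lincomb:
  assumes "f \<in> C0" "g \<in> C0"
  shows "(\<lambda>t. a * f t + b * g t) \<in> C0"
  by (rule C0I[where h = "\<lambda>x. a * Psi_quot f x + b * Psi_quot g x"])
    (use Psi_quot_props[OF assms(1)] Psi_quot_props[OF assms(2)] in
      \<open>auto intro!: continuous_intros simp: algebra_simps\<close>)

lemma C0_zero: "(\<lambda>t. 0) \<in> C0"
  by (rule C0I[where h = "\<lambda>x. 0"]) auto

lemma C0_diff: "f \<in> C0 \<Longrightarrow> g \<in> C0 \<Longrightarrow> (\<lambda>t. f t - g t) \<in> C0"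
  using C0_lincomb[of f g 1 "-1"] by simp

lemma C0_sum: "(\<And>k. k < (N::nat) \<Longrightarrow> f k \<in> C0) \<Longrightarrow> (\<lambda>t. \<Sum>k<N. f k t) \<in> C0"
proof (induction N)
  case 0 show ?case by (simp add: C0_zero)
next
  case (Suc N)
  then show ?case using C0_lincomb[of "\<lambda>t. \<Sum>k<N. f k t" "f N" 1 1] by simp
qed

section \<open>The norm of C0 as the best multiple of Psi\<close>

lemma norm0_bounds:
  assumes "f \<in> C0"
  shows "0 \<le> norm0 f" and "x \<in> {0..1} \<Longrightarrow> \<bar>f x\<bar> \<le> norm0 f * Psi x"
proof -
  have "bounded (Psi_quot f ` {0..1})"
    by (intro compact_imp_bounded compact_continuous_image Psi_quot_props assms) auto
  then obtain M where "\<forall>x\<in>{0..1}. \<bar>Psi_quot f x\<bar> \<le> M"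
    unfolding bounded_iff by auto
  then have bdd: "bdd_above ((\<lambda>x. \<bar>Psi_quot f x\<bar>) ` {0..1})"
    by (auto intro!: bdd_aboveI2)
  have up: "\<bar>Psi_quot f x\<bar> \<le> norm0 f" if "x \<in> {0..1}" for x
    unfolding norm0_def sup_norm_def by (rule cSUP_upper[OF that bdd])
  show "0 \<le> norm0 f" using up[of 0] by auto
  show "\<bar>f x\<bar> \<le> norm0 f * Psi x" if "x \<in> {0..1}"
    using up[OF that] Psi_quot_props(2)[OF assms that] Psi_nonneg[OF that]
    by (simp add: abs_mult mult.commute mult_left_mono)
qed

lemma Psi_quot_bound:
  assumes "f \<in> C0" "\<And>x. x \<in> {0..1} \<Longrightarrow> \<bar>f x\<bar> \<le> c * Psi x" "x \<in> {0..1}"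
  shows "\<bar>Psi_quot f x\<bar> \<le> c"
  by (rule Psi_mult_bound_cancel[OF Psi_quot_props(1)[OF assms(1)] _ assms(3)])
    (use assms(2) Psi_quot_props(2)[OF assms(1)] in auto)

lemma norm0_le:
  assumes "f \<in> C0" "\<And>x. x \<in> {0..1} \<Longrightarrow> \<bar>f x\<bar> \<le> c * Psi x"
  shows "norm0 f \<le> c"
  unfolding norm0_def sup_norm_def
  by (rule cSUP_least) (use Psi_quot_bound[OF assms] in auto)

text \<open>Contraction with respect to \<open>norm0\<close>, put in pointwise form so that neither
  suprema nor chosen quotients occur.\<close>

definition Psi_contraction :: "((real \<Rightarrow> real) \<Rightarrow> real \<Rightarrow> real) \<Rightarrow> real \<Rightarrow> bool" where
  "Psi_contraction T \<gamma> \<longleftrightarrow> linear_on_C0 T \<and> 0 \<le> \<gamma> \<and> \<gamma> < 1 \<and>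
     (\<forall>f\<in>C0. \<forall>c. (\<forall>x\<in>{0..1}. \<bar>f x\<bar> \<le> c * Psi x) \<longrightarrow> (\<forall>x\<in>{0..1}. \<bar>T f x\<bar> \<le> \<gamma> * c * Psi x))"

text \<open>The a priori bound with some \<open>C\<close> is improved by iteration; \<open>d\<close> need not lie in \<open>C0\<close>.\<close>

lemma Psi_residual_bound:
  fixes d Td :: "real \<Rightarrow> real"
  assumes contr: "\<And>c. (\<forall>x\<in>{0..1}. \<bar>d x\<bar> \<le> c * Psi x) \<Longrightarrow> (\<forall>x\<in>{0..1}. \<bar>Td x\<bar> \<le> \<gamma> * c * Psi x)"
    and \<gamma>: "0 \<le> \<gamma>" "\<gamma> < 1"
    and C: "\<And>x. x \<in> {0..1} \<Longrightarrow> \<bar>d x\<bar> \<le> C * Psi x"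
    and r: "\<And>x. x \<in> {0..1} \<Longrightarrow> \<bar>d x - Td x\<bar> \<le> r * Psi x"
    and x: "x \<in> {0..1}"
  shows "\<bar>d x\<bar> \<le> r / (1 - \<gamma>) * Psi x"
proof -
  \<comment> \<open>Fixed point of c -> \<gamma> c + r, the map that turns one bound for
    \<open>d\<close> into the next; the iterates starting at \<open>C\<close> approach it like
    \<gamma>^N.\<close>
  define K where "K = r / (1 - \<gamma>)"
  have K: "\<gamma> * K + r = K" using \<gamma> by (simp add: K_def field_simps)
  have b: "\<forall>x\<in>{0..1}. \<bar>d x\<bar> \<le> (K + \<gamma> ^ N * (C - K)) * Psi x" for N
  proof (induction N)
    case 0 show ?case using C by simp
  next
    case (Suc N)
    show ?case
    proof
      fix t :: real assume t: "t \<in> {0..1}"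
      have "\<bar>d t\<bar> \<le> \<bar>Td t\<bar> + \<bar>d t - Td t\<bar>" by simp
      also have "\<dots> \<le> \<gamma> * (K + \<gamma> ^ N * (C - K)) * Psi t + r * Psi t"
        using contr[OF Suc.IH] r[OF t] t by (intro add_mono) auto
      also have "\<dots> = ((\<gamma> * K + r) + \<gamma> ^ Suc N * (C - K)) * Psi t"
        by (simp add: algebra_simps)
      finally show "\<bar>d t\<bar> \<le> (K + \<gamma> ^ Suc N * (C - K)) * Psi t" by (simp only: K)
    qed
  qed
  have "(\<lambda>N. (K + \<gamma> ^ N * (C - K)) * Psi x) \<longlonglongrightarrow> (K + 0 * (C - K)) * Psi x"
    by (intro tendsto_intros LIMSEQ_power_zero) (use \<gamma> in auto)
  from LIMSEQ_le_const[OF this] b x show ?thesis by (auto simp: K_def)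
qed

context
  fixes T :: "(real \<Rightarrow> real) \<Rightarrow> real \<Rightarrow> real" and \<gamma> :: real
  assumes T: "Psi_contraction T \<gamma>"
begin

lemma contraction_C0: "f \<in> C0 \<Longrightarrow> T f \<in> C0"
  using T by (simp add: Psi_contraction_def linear_on_C0_def)

lemma contraction_linear:
  "f \<in> C0 \<Longrightarrow> g \<in> C0 \<Longrightarrow> x \<in> {0..1} \<Longrightarrow> T (\<lambda>t. a * f t + b * g t) x = a * T f x + b * T g x"
  using T by (simp add: Psi_contraction_def linear_on_C0_def)

lemma contraction_bound:
  "f \<in> C0 \<Longrightarrow> (\<And>x. x \<in> {0..1} \<Longrightarrow> \<bar>f x\<bar> \<le> c * Psi x) \<Longrightarrow> x \<in> {0..1} \<Longrightarrow> \<bar>T f x\<bar> \<le> \<gamma> * c * Psi x"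
  using T unfolding Psi_contraction_def by blast

lemma contraction_factor: "0 \<le> \<gamma>" "\<gamma> < 1"
  using T by (simp_all add: Psi_contraction_def)

lemma contraction_diff:
  "f \<in> C0 \<Longrightarrow> g \<in> C0 \<Longrightarrow> x \<in> {0..1} \<Longrightarrow> T (\<lambda>t. f t - g t) x = T f x - T g x"
  using contraction_linear[of f g x 1 "-1"] by simp

text \<open>Functions that agree on [0,1] may differ elsewhere, so this is not plain congruence; the
  contraction bound with c = 0 is applied to their difference.\<close>

lemma contraction_cong:
  assumes "f \<in> C0" "g \<in> C0" "\<And>x. x \<in> {0..1} \<Longrightarrow> f x = g x" "x \<in> {0..1}"
  shows "T f x = T g x"
  using contraction_bound[OF C0_diff[OF assms(1,2)], of 0 x] assms contraction_diff[OF assms(1,2,4)]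
  by simp

lemma contraction_sum:
  assumes "\<And>k. f k \<in> C0" "x \<in> {0..1}"
  shows "T (\<lambda>t. \<Sum>k<N::nat. f k t) x = (\<Sum>k<N. T (f k) x)"
proof (induction N)
  case 0
  show ?case using contraction_linear[OF C0_zero C0_zero assms(2), of 0 0] by simp
next
  case (Suc N)
  have "T (\<lambda>t. 1 * (\<Sum>k<N. f k t) + 1 * f N t) x = 1 * T (\<lambda>t. \<Sum>k<N. f k t) x + 1 * T (f N) x"
    by (rule contraction_linear) (use assms C0_sum in auto)
  then show ?case using Suc by simp
qed

lemma contraction_power_C0: "f \<in> C0 \<Longrightarrow> (T ^^ k) f \<in> C0"
  by (induction k) (auto intro: contraction_C0)

lemma contraction_power_bound:
  assumes "f \<in> C0" "\<And>x. x \<in> {0..1} \<Longrightarrow> \<bar>f x\<bar> \<le> c * Psi x" "x \<in> {0..1}"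
  shows "\<bar>(T ^^ k) f x\<bar> \<le> \<gamma> ^ k * c * Psi x"
  using assms(3)
proof (induction k arbitrary: x)
  case 0 then show ?case using assms by simp
next
  case (Suc k)
  show ?case
    using contraction_bound[OF contraction_power_C0[OF assms(1)] Suc.IH Suc.prems]
    by (simp add: mult.assoc)
qed

lemma contraction_power_linear:
  assumes "f \<in> C0" "g \<in> C0" "x \<in> {0..1}"
  shows "(T ^^ k) (\<lambda>t. a * f t + b * g t) x = a * (T ^^ k) f x + b * (T ^^ k) g x"
  using assms(3)
proof (induction k arbitrary: x)
  case (Suc k)
  have "T ((T ^^ k) (\<lambda>t. a * f t + b * g t)) x = T (\<lambda>t. a * (T ^^ k) f t + b * (T ^^ k) g t) x"
    using Suc by (intro contraction_cong contraction_power_C0 C0_lincomb assms) auto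
  also have "\<dots> = a * T ((T ^^ k) f) x + b * T ((T ^^ k) g) x"
    by (intro contraction_linear contraction_power_C0 assms Suc.prems)
  finally show ?case by simp
qed simp

text \<open>The quotients by \<open>Psi\<close> are summed rather than the functions: their series
  converges uniformly on [0,1], so the result is visibly \<open>Psi\<close> times a continuous
  function.\<close>

definition neumann :: "(real \<Rightarrow> real) \<Rightarrow> real \<Rightarrow> real" where
  "neumann f x = Psi x * (\<Sum>k. Psi_quot ((T ^^ k) f) x)"

lemma quot_power_bound:
  assumes "f \<in> C0" "x \<in> {0..1}"
  shows "\<bar>Psi_quot ((T ^^ k) f) x\<bar> \<le> norm0 f * \<gamma> ^ k"
  by (rule Psi_quot_bound[OF contraction_power_C0[OF assms(1)] _ assms(2)])
    (use contraction_power_bound[OF assms(1) norm0_bounds(2)[OF assms(1)]] in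
      \<open>simp add: mult_ac\<close>)

lemma summable_quot_power:
  assumes "f \<in> C0" "x \<in> {0..1}"
  shows "summable (\<lambda>k. Psi_quot ((T ^^ k) f) x)"
  by (rule summable_comparison_test'[where g = "\<lambda>k. norm0 f * \<gamma> ^ k"])
    (use quot_power_bound[OF assms] contraction_factor in \<open>auto intro!: summable_mult summable_geometric\<close>)

lemma neumann_sums:
  assumes "f \<in> C0" "x \<in> {0..1}"
  shows "(\<lambda>k. (T ^^ k) f x) sums neumann f x"
  using sums_mult[OF summable_sums[OF summable_quot_power[OF assms]], of "Psi x"]
  unfolding neumann_def
  by (simp add: Psi_quot_props(2)[OF contraction_power_C0[OF assms(1)] assms(2)])

lemma neumann_C0:
  assumes "f \<in> C0"
  shows "neumann f \<in> C0"
proof (rule C0I)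
  have "uniform_limit {0..1} (\<lambda>N x. \<Sum>k<N. Psi_quot ((T ^^ k) f) x)
          (\<lambda>x. \<Sum>k. Psi_quot ((T ^^ k) f) x) sequentially"
    by (rule Weierstrass_m_test[where M = "\<lambda>k. norm0 f * \<gamma> ^ k"])
      (use quot_power_bound[OF assms] contraction_factor in \<open>auto intro!: summable_mult summable_geometric\<close>)
  then show "continuous_on {0..1} (\<lambda>x. \<Sum>k. Psi_quot ((T ^^ k) f) x)"
    by (rule uniform_limit_theorem[rotated])
      (auto intro!: always_eventually continuous_intros Psi_quot_props contraction_power_C0 assms)
qed (simp add: neumann_def)

text \<open>Geometric tail. It serves both the convergence in \<open>opnorm0\<close> and the passage
  of \<open>T\<close> through the infinite sum.\<close>

lemma neumann_remainder:
  assumes "f \<in> C0" "\<And>x. x \<in> {0..1} \<Longrightarrow> \<bar>f x\<bar> \<le> c * Psi x" "x \<in> {0..1}"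
  shows "\<bar>neumann f x - (\<Sum>k<N. (T ^^ k) f x)\<bar> \<le> \<gamma> ^ N / (1 - \<gamma>) * c * Psi x"
proof -
  have s: "(\<lambda>k. (T ^^ (k + N)) f x) sums (neumann f x - (\<Sum>k<N. (T ^^ k) f x))"
    by (rule sums_split_initial_segment[OF neumann_sums[OF assms(1,3)]])
  have g: "(\<lambda>k. \<gamma> ^ N * c * Psi x * \<gamma> ^ k) sums (\<gamma> ^ N * c * Psi x * (1 / (1 - \<gamma>)))"
    using contraction_factor by (intro sums_mult geometric_sums) auto
  have b: "\<bar>(T ^^ (k + N)) f x\<bar> \<le> \<gamma> ^ N * c * Psi x * \<gamma> ^ k" for k
    using contraction_power_bound[OF assms, of "k + N"] by (simp add: power_add mult_ac)
  have "neumann f x - (\<Sum>k<N. (T ^^ k) f x) \<le> \<gamma> ^ N * c * Psi x * (1 / (1 - \<gamma>))"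
    by (rule sums_le[OF _ s g]) (use b abs_le_D1 in blast)
  moreover have "- (neumann f x - (\<Sum>k<N. (T ^^ k) f x)) \<le> \<gamma> ^ N * c * Psi x * (1 / (1 - \<gamma>))"
    by (rule sums_le[OF _ sums_minus[OF s] g]) (use b abs_le_D2 in blast)
  ultimately show ?thesis by (simp add: abs_le_iff mult_ac)
qed

text \<open>Supplies the witness without which the SOME in \<open>power_series_op\<close> would be
  meaningless.\<close>

lemma power_series_sums_neumann: "power_series_sums T neumann"
proof -
  have lin: "linear_on_C0 neumann"
    unfolding linear_on_C0_def
  proof (intro conjI ballI allI neumann_C0)
    fix f g :: "real \<Rightarrow> real" and a b x :: real
    assume fg: "f \<in> C0" "g \<in> C0" and x: "x \<in> {0..1}"
    have "(\<lambda>k. a * (T ^^ k) f x + b * (T ^^ k) g x) sums (a * neumann f x + b * neumann g x)"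
      by (intro sums_add sums_mult neumann_sums fg x)
    moreover have "(\<lambda>k. a * (T ^^ k) f x + b * (T ^^ k) g x) sums neumann (\<lambda>t. a * f t + b * g t) x"
      using neumann_sums[OF C0_lincomb[OF fg] x] by (simp add: contraction_power_linear[OF fg x])
    ultimately show "neumann (\<lambda>t. a * f t + b * g t) x = a * neumann f x + b * neumann g x"
      using sums_unique2 by blast
  qed
  have "opnorm0 (\<lambda>f x. neumann f x - (\<Sum>k<N. (T ^^ k) f x)) \<le> ennreal (\<gamma> ^ N / (1 - \<gamma>))" for N
    unfolding opnorm0_def
  proof (rule SUP_least)
    fix f assume "f \<in> {f \<in> C0. norm0 f \<le> 1}"
    then have f: "f \<in> C0" "norm0 f \<le> 1" by auto
    have f1: "\<bar>f x\<bar> \<le> 1 * Psi x" if "x \<in> {0..1}" for x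
      using norm0_bounds(2)[OF f(1) that] mult_right_mono[OF f(2) Psi_nonneg[OF that]] by simp
    have "norm0 (\<lambda>x. neumann f x - (\<Sum>k<N. (T ^^ k) f x)) \<le> \<gamma> ^ N / (1 - \<gamma>)"
      by (rule norm0_le)
        (use neumann_remainder[OF f(1) f1] in
          \<open>auto intro!: C0_diff neumann_C0 C0_sum contraction_power_C0 f\<close>)
    then show "ennreal (norm0 (\<lambda>x. neumann f x - (\<Sum>k<N. (T ^^ k) f x))) \<le> ennreal (\<gamma> ^ N / (1 - \<gamma>))"
      by (rule ennreal_leI)
  qed
  moreover have "(\<lambda>N. ennreal (\<gamma> ^ N / (1 - \<gamma>))) \<longlonglongrightarrow> 0"
  proof -
    have "(\<lambda>N. \<gamma> ^ N / (1 - \<gamma>)) \<longlonglongrightarrow> 0 / (1 - \<gamma>)"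
      using contraction_factor by (intro tendsto_intros LIMSEQ_power_zero) auto
    then show ?thesis using tendsto_ennrealI by fastforce
  qed
  ultimately have "(\<lambda>N. opnorm0 (\<lambda>f x. neumann f x - (\<Sum>k<N. (T ^^ k) f x))) \<longlonglongrightarrow> 0"
    by (rule tendsto_sandwich[OF _ always_eventually tendsto_const, rotated, OF allI]) simp
  with lin show ?thesis by (simp add: power_series_sums_def)
qed

text \<open>Counterpart to existence: every admissible \<open>S\<close> has the same values on
  \<open>C0\<close> and [0,1], so the choice in \<open>power_series_op\<close> does not
  matter.\<close>

lemma power_series_sums_pointwise:
  assumes S: "power_series_sums T S" and f: "f \<in> C0" and x: "x \<in> {0..1}"
  shows "(\<lambda>k. (T ^^ k) f x) sums S f x"
proof -
  have lin: "linear_on_C0 S" and lim: "(\<lambda>N. opnorm0 (\<lambda>f x. S f x - (\<Sum>k<N. (T ^^ k) f x))) \<longlonglongrightarrow> 0"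
    using S by (auto simp: power_series_sums_def)
  \<comment> \<open>\<open>opnorm0\<close> tests only the unit ball, so \<open>f\<close> is scaled
    by 1 / c; adding 1 keeps \<open>c\<close> positive even when \<open>norm0 f\<close> is
    0.\<close>
  define c where "c = norm0 f + 1"
  have c: "c > 0" using norm0_bounds(1)[OF f] by (simp add: c_def)
  \<comment> \<open>The zero summand fits the two-term shape of \<open>linear_on_C0\<close>.\<close>
  define g where "g = (\<lambda>t. (1 / c) * f t + 0 * f t)"
  have g: "g \<in> C0" unfolding g_def by (rule C0_lincomb[OF f f])
  have g1: "norm0 g \<le> 1"
  proof (rule norm0_le[OF g])
    fix t :: real assume t: "t \<in> {0..1}"
    have "\<bar>f t\<bar> \<le> c * Psi t"
      using norm0_bounds(2)[OF f t] Psi_nonneg[OF t] by (simp add: c_def algebra_simps)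
    then show "\<bar>g t\<bar> \<le> 1 * Psi t"
      using c by (simp add: g_def abs_mult field_simps)
  qed
  define D where "D N = (\<lambda>x. S g x - (\<Sum>k<N. (T ^^ k) g x))" for N
  have D: "D N \<in> C0" for N
    unfolding D_def using lin g
    by (auto intro!: C0_diff C0_sum contraction_power_C0 simp: linear_on_C0_def)
  have "ennreal (norm0 (D N)) \<le> opnorm0 (\<lambda>f x. S f x - (\<Sum>k<N. (T ^^ k) f x))" for N
    unfolding opnorm0_def D_def by (rule SUP_upper2[where i = g]) (use g g1 in auto)
  then have "(\<lambda>N. ennreal (norm0 (D N))) \<longlonglongrightarrow> 0"
    by (intro tendsto_sandwich[OF _ _ tendsto_const lim]) auto
  then have n0: "(\<lambda>N. norm0 (D N)) \<longlonglongrightarrow> 0"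
    using norm0_bounds(1)[OF D] by (simp add: ennreal_0[symmetric] del: ennreal_0)
  have "(\<lambda>N. D N x) \<longlonglongrightarrow> 0"
  proof (rule Lim_null_comparison)
    show "\<forall>\<^sub>F N in sequentially. norm (D N x) \<le> norm0 (D N) * Psi x"
      using norm0_bounds(2)[OF D x] by simp
    show "(\<lambda>N. norm0 (D N) * Psi x) \<longlonglongrightarrow> 0"
      using tendsto_mult_right[OF n0, of "Psi x"] by simp
  qed
  then have "(\<lambda>N. c * D N x) \<longlonglongrightarrow> 0"
    using tendsto_mult_left[of "\<lambda>N. D N x" 0 sequentially c] by simp
  moreover have "c * D N x = S f x - (\<Sum>k<N. (T ^^ k) f x)" for N
  proof -
    have "S g x = (1 / c) * S f x + 0 * S f x"
      using lin f x unfolding g_def linear_on_C0_def by blast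
    moreover have "(T ^^ k) g x = (1 / c) * (T ^^ k) f x + 0 * (T ^^ k) f x" for k
      unfolding g_def by (rule contraction_power_linear[OF f f x])
    ultimately show ?thesis using c by (simp add: D_def right_diff_distrib sum_distrib_left)
  qed
  ultimately have "(\<lambda>N. S f x - (\<Sum>k<N. (T ^^ k) f x)) \<longlonglongrightarrow> 0" by simp
  from tendsto_diff[OF tendsto_const[of "S f x"] this] show ?thesis
    by (simp add: sums_def)
qed

lemma power_series_op_eq_neumann:
  assumes "f \<in> C0" "x \<in> {0..1}"
  shows "power_series_op T f x = neumann f x"
proof -
  have "power_series_sums T (power_series_op T)"
    unfolding power_series_op_def 
    by (rule someI[of _ neumann]) (rule power_series_sums_neumann)
  from power_series_sums_pointwise[OF this assms] neumann_sums[OF assms] show ?thesis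
    by (rule sums_unique2)
qed

lemma power_series_op_C0: "f \<in> C0 \<Longrightarrow> power_series_op T f \<in> C0"
  by (rule C0_cong[OF neumann_C0 power_series_op_eq_neumann])

text \<open>\<open>T\<close> is additive for finite sums only. Applying it to the Neumann tail,
  which is small relative to \<open>Psi\<close>, gives the limit.\<close>

lemma power_series_op_fixpoint:
  assumes f: "f \<in> C0" and x: "x \<in> {0..1}"
  shows "power_series_op T f x = f x + T (power_series_op T f) x"
proof -
  have N: "neumann f \<in> C0" by (rule neumann_C0[OF f])
  have P: "(\<lambda>t. \<Sum>k<M. (T ^^ k) f t) \<in> C0" for M by (intro C0_sum contraction_power_C0 f)
  have "\<bar>T (neumann f) x - (\<Sum>k<M. (T ^^ Suc k) f x)\<bar> \<le> \<gamma> * (\<gamma> ^ M / (1 - \<gamma>) * norm0 f) * Psi x" for M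
  proof -
    have "\<bar>T (\<lambda>t. neumann f t - (\<Sum>k<M. (T ^^ k) f t)) x\<bar> \<le> \<gamma> * (\<gamma> ^ M / (1 - \<gamma>) * norm0 f) * Psi x"
      by (rule contraction_bound[OF C0_diff[OF N P] _ x])
        (rule neumann_remainder[OF f norm0_bounds(2)[OF f]])
    then show ?thesis
      by (simp add: contraction_diff[OF N P x] contraction_sum[OF contraction_power_C0[OF f] x])
  qed
  moreover have "(\<lambda>M. \<gamma> * (\<gamma> ^ M / (1 - \<gamma>) * norm0 f) * Psi x) \<longlonglongrightarrow> \<gamma> * (0 / (1 - \<gamma>) * norm0 f) * Psi x"
    using contraction_factor by (intro tendsto_intros LIMSEQ_power_zero) auto
  ultimately have "(\<lambda>M. T (neumann f) x - (\<Sum>k<M. (T ^^ Suc k) f x)) \<longlonglongrightarrow> 0"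
    using Lim_null_comparison[where f = "\<lambda>M. T (neumann f) x - (\<Sum>k<M. (T ^^ Suc k) f x)"
        and g = "\<lambda>M. \<gamma> * (\<gamma> ^ M / (1 - \<gamma>) * norm0 f) * Psi x"]
    by simp
  from tendsto_diff[OF tendsto_const[of "T (neumann f) x"] this]
  have "(\<lambda>k. (T ^^ Suc k) f x) sums T (neumann f) x" by (simp add: sums_def)
  \<comment> \<open>Prepending the term with index 0, which is \<open>f x\<close>.\<close>
  from sums_Suc[OF this] have "(\<lambda>k. (T ^^ k) f x) sums (T (neumann f) x + f x)" by simp
  with neumann_sums[OF f x] have "neumann f x = T (neumann f) x + f x" by (rule sums_unique2)
  moreover have "T (power_series_op T f) x = T (neumann f) x"
    by (intro contraction_cong power_series_op_C0 N f x power_series_op_eq_neumann)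
  ultimately show ?thesis using power_series_op_eq_neumann[OF f x] by simp
qed

end

section \<open>The operators U and B\<close>

lemma Bernstein_factor_Psi:
  assumes "k \<in> {1..n - 1}"
  shows "Bernstein n k x = Psi x * (of_nat (n choose k) * x ^ (k - 1) * (1 - x) ^ (n - k - 1))"
proof -
  have "k = Suc (k - 1)" "n - k = Suc (n - k - 1)" using assms by auto
  then have "x ^ k = x * x ^ (k - 1)" "(1 - x) ^ (n - k) = (1 - x) * (1 - x) ^ (n - k - 1)"
    by (metis power_Suc)+
  then show ?thesis by (simp add: Bernstein_def Psi_def)
qed

text \<open>Turns errors at the nodes into a residual bounded by a multiple of \<open>Psi\<close>.
  Only interior nodes qualify: the basis functions for k = 0 and k = n equal 1 at an end
  point.\<close>

lemma Bernstein_le_Psi: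
  assumes "k \<in> {1..n - 1}" "x \<in> {0..1}"
  shows "Bernstein n k x \<le> real (n choose k) * Psi x"
proof -
  have "x ^ (k - 1) * (1 - x) ^ (n - k - 1) \<le> 1 * 1"
    using assms(2) by (intro mult_mono power_le_one) auto
  then have "(Psi x * real (n choose k)) * (x ^ (k - 1) * (1 - x) ^ (n - k - 1)) \<le> (Psi x * real (n choose k)) * 1"
    using Psi_nonneg[OF assms(2)] by (intro mult_left_mono) auto
  then show ?thesis using Bernstein_factor_Psi[OF assms(1)] by (simp add: mult_ac)
qed

lemma Bernstein_nonneg_Icc: "x \<in> {0..1} \<Longrightarrow> 0 \<le> Bernstein n k x"
  by (simp add: Bernstein_nonneg)

text \<open>\<open>Psi\<close> is an eigenfunction of the Bernstein operator, and its eigenvalue is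
  the contraction factor. The values at the nodes are expanded in k and k (k - 1), whose Bernstein
  sums are known.\<close>

lemma sum_Psi_Bernstein:
  assumes "n \<ge> 1"
  shows "(\<Sum>k\<le>n. Psi (real k / real n) * Bernstein n k x) = (1 - 1 / real n) * Psi x"
proof -
  have "Psi (real k / real n) * Bernstein n k x =
      ((real n - 1) / (real n)\<^sup>2) * (real k * Bernstein n k x)
      - (1 / (real n)\<^sup>2) * (real k * (real k - 1) * Bernstein n k x)" for k
    using assms by (simp add: Psi_def field_simps power2_eq_square)
  then have "(\<Sum>k\<le>n. Psi (real k / real n) * Bernstein n k x) =
      ((real n - 1) / (real n)\<^sup>2) * (real n * x) - (1 / (real n)\<^sup>2) * (real n * (real n - 1) * x\<^sup>2)"
    by (simp only: sum_subtractf sum_distrib_left[symmetric] sum_k_Bernstein sum_kk_Bernstein)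
  also have "\<dots> = (1 - 1 / real n) * Psi x"
    using assms by (simp add: Psi_def field_simps power2_eq_square)
  finally show ?thesis .
qed

lemma sum_drop_endpoints:
  fixes g :: "nat \<Rightarrow> real"
  assumes "n \<ge> 1" "g 0 = 0" "g n = 0"
  shows "(\<Sum>k\<le>n. g k) = (\<Sum>k=1..n-1. g k)"
proof (rule sum.mono_neutral_right)
  show "\<forall>i\<in>{..n} - {1..n - 1}. g i = 0"
  proof
    fix i assume "i \<in> {..n} - {1..n - 1}"
    then have "i = 0 \<or> i = n" by auto
    then show "g i = 0" using assms by auto
  qed
qed auto

lemma sum_Psi_Bernstein_interior:
  assumes "n \<ge> 1"
  shows "(\<Sum>k=1..n-1. Psi (real k / real n) * Bernstein n k x) = (1 - 1 / real n) * Psi x"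
  using sum_drop_endpoints[OF assms, of "\<lambda>k. Psi (real k / real n) * Bernstein n k x"]
    sum_Psi_Bernstein[OF assms] assms by simp

text \<open>Treats both operators at once: \<open>l k\<close> is point evaluation at k / n with
  \<theta> = 1, or a Beta mean with \<theta> = n \<rho> / (n \<rho> + 1).\<close>

lemma Psi_contraction_Bernstein_form:
  assumes T: "\<And>f x. f \<in> C0 \<Longrightarrow> T f x = (\<Sum>k=1..n-1. l k f * Bernstein n k x)"
    and lin: "\<And>k f g a b. k \<in> {1..n-1} \<Longrightarrow> f \<in> C0 \<Longrightarrow> g \<in> C0 \<Longrightarrow>
                l k (\<lambda>t. a * f t + b * g t) = a * l k f + b * l k g"
    and bound: "\<And>k f c. k \<in> {1..n-1} \<Longrightarrow> f \<in> C0 \<Longrightarrow> (\<And>x. x \<in> {0..1} \<Longrightarrow> \<bar>f x\<bar> \<le> c * Psi x) \<Longrightarrow>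
                \<bar>l k f\<bar> \<le> c * (\<theta> * Psi (real k / real n))"
    and \<theta>: "0 \<le> \<theta>" "\<theta> \<le> 1" and n: "n \<ge> 1"
  shows "Psi_contraction T (\<theta> * (1 - 1 / real n))"
  unfolding Psi_contraction_def
proof (intro conjI ballI allI impI)
  show "linear_on_C0 T" unfolding linear_on_C0_def
  proof (intro conjI ballI allI)
    fix f assume f: "f \<in> C0"
    show "T f \<in> C0"
      \<comment> \<open>Each interior Bernstein polynomial contains the factor \<open>Psi\<close>;
        removing it leaves a polynomial quotient.\<close>
      by (rule C0I[where h = "\<lambda>x. \<Sum>k=1..n-1. l k f * (of_nat (n choose k) * x ^ (k - 1) * (1 - x) ^ (n - k - 1))"])
        (auto intro!: continuous_intros sum.cong
          simp: T[OF f] Bernstein_factor_Psi sum_distrib_left mult_ac)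
  next
    fix f g :: "real \<Rightarrow> real" and a b x assume fg: "f \<in> C0" "g \<in> C0"
    have "T (\<lambda>t. a * f t + b * g t) x = (\<Sum>k=1..n-1. (a * l k f + b * l k g) * Bernstein n k x)"
      by (subst T[OF C0_lincomb[OF fg]]) (auto intro!: sum.cong simp: lin[OF _ fg])
    then show "T (\<lambda>t. a * f t + b * g t) x = a * T f x + b * T g x"
      by (simp add: T[OF fg(1)] T[OF fg(2)] distrib_right sum.distrib sum_distrib_left mult.assoc)
  qed
next
  show "0 \<le> \<theta> * (1 - 1 / real n)" using \<theta> n by simp
  have "\<theta> * (1 - 1 / real n) \<le> 1 * (1 - 1 / real n)" using \<theta> n by (intro mult_right_mono) auto
  also have "\<dots> < 1" using n by simp
  finally show "\<theta> * (1 - 1 / real n) < 1" .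
next
  fix f c x assume f: "f \<in> C0" and c: "\<forall>x\<in>{0..1}. \<bar>f x\<bar> \<le> c * Psi x" and x: "x \<in> {0..1::real}"
  have "\<bar>T f x\<bar> \<le> (\<Sum>k=1..n-1. \<bar>l k f * Bernstein n k x\<bar>)"
    unfolding T[OF f] by (rule sum_abs)
  also have "\<dots> \<le> (\<Sum>k=1..n-1. c * (\<theta> * Psi (real k / real n)) * Bernstein n k x)"
    using bound[OF _ f, of _ c] c Bernstein_nonneg_Icc[OF x]
    by (intro sum_mono) (simp add: abs_mult mult_right_mono)
  also have "\<dots> = c * \<theta> * (\<Sum>k=1..n-1. Psi (real k / real n) * Bernstein n k x)"
    by (simp add: sum_distrib_left mult_ac)
  also have "\<dots> = \<theta> * (1 - 1 / real n) * c * Psi x"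
    by (simp add: sum_Psi_Bernstein_interior[OF n, simplified])
  finally show "\<bar>T f x\<bar> \<le> \<theta> * (1 - 1 / real n) * c * Psi x" .
qed

lemma bernstein_op_interior:
  assumes "f 0 = 0" "f 1 = 0" "n \<ge> 1"
  shows "bernstein_op n f x = (\<Sum>k=1..n-1. f (real k / real n) * Bernstein n k x)"
  unfolding bernstein_op_def atMost_atLeast0[symmetric]
  using assms by (intro sum_drop_endpoints) auto

lemma node_add: "k \<in> {1..n - 1} \<Longrightarrow> real k + real (n - k) = real n"
  using of_nat_add[of k "n - k", where 'a = real] by force

lemma node_in_unit: "k \<in> {1..n - 1} \<Longrightarrow> real k / real n \<in> {0..1}"
  by auto

lemma Psi_contraction_bernstein_op:
  assumes n: "n \<ge> 1"
  shows "Psi_contraction (bernstein_op n) (1 - 1 / real n)"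
proof -
  have "Psi_contraction (bernstein_op n) (1 * (1 - 1 / real n))"
    by (rule Psi_contraction_Bernstein_form[where l = "\<lambda>k f. f (real k / real n)"])
      (use n node_in_unit C0_endpoints bernstein_op_interior in auto)
  then show ?thesis by simp
qed

section \<open>Means with respect to the Beta distribution\<close>

definition beta_mean :: "real \<Rightarrow> real \<Rightarrow> (real \<Rightarrow> real) \<Rightarrow> real" where
  "beta_mean a b f = integral {0..1} (\<lambda>t. t powr (a - 1) * (1 - t) powr (b - 1) / Beta a b * f t)"

context
  fixes a b :: real
  assumes ab: "0 < a" "0 < b"
begin

lemma Beta_pos: "0 < Beta a b"
  using ab by (simp add: Beta_def)

text \<open>The weight is unbounded near 0 or 1 when a < 1 or b < 1, so continuity alone does not
  suffice; an absolutely integrable weight times a bounded measurable function is used.\<close>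

lemma beta_weight_integrable:
  assumes "continuous_on {0..1} f"
  shows "(\<lambda>t. t powr (a - 1) * (1 - t) powr (b - 1) / Beta a b * f t) integrable_on {0..1}"
proof -
  have "(\<lambda>t. t powr (a - 1) * (1 - t) powr (b - 1)) absolutely_integrable_on {0..1}"
    using has_integral_Beta_real[OF ab] by (intro nonnegative_absolutely_integrable_1) auto
  moreover have "bounded (f ` {0..1})"
    by (intro compact_imp_bounded compact_continuous_image assms) auto
  ultimately have "(\<lambda>t. f t * (t powr (a - 1) * (1 - t) powr (b - 1))) absolutely_integrable_on {0..1}"
    by (intro absolutely_integrable_bounded_measurable_product_real[where f = f]
        continuous_imp_measurable_on_sets_lebesgue assms) auto
  then have "(\<lambda>t. f t * (t powr (a - 1) * (1 - t) powr (b - 1))) integrable_on {0..1}"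
    by (rule set_lebesgue_integral_eq_integral(1))
  from integrable_on_cmult_left[OF this, of "1 / Beta a b"] show ?thesis by (simp add: mult_ac)
qed

lemma beta_mean_linear:
  assumes "continuous_on {0..1} f" "continuous_on {0..1} g"
  shows "beta_mean a b (\<lambda>t. c * f t + d * g t) = c * beta_mean a b f + d * beta_mean a b g"
proof -
  have "beta_mean a b (\<lambda>t. c * f t + d * g t) =
      integral {0..1} (\<lambda>t. c *\<^sub>R (t powr (a - 1) * (1 - t) powr (b - 1) / Beta a b * f t)
        + d *\<^sub>R (t powr (a - 1) * (1 - t) powr (b - 1) / Beta a b * g t))"
    unfolding beta_mean_def by (rule integral_cong) (simp add: algebra_simps add_divide_distrib)
  also have "\<dots> = c * beta_mean a b f + d * beta_mean a b g"
    unfolding beta_mean_def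
      integral_add[OF integrable_cmul[OF beta_weight_integrable[OF assms(1)]]
        integrable_cmul[OF beta_weight_integrable[OF assms(2)]]] integral_cmul
    by simp
  finally show ?thesis .
qed

lemma beta_mean_bound:
  assumes "continuous_on {0..1} f" "continuous_on {0..1} g" "\<And>t. t \<in> {0..1} \<Longrightarrow> \<bar>f t\<bar> \<le> g t"
  shows "\<bar>beta_mean a b f\<bar> \<le> beta_mean a b g"
proof -
  have "norm (beta_mean a b f) \<le> beta_mean a b g"
    unfolding beta_mean_def
  proof (rule integral_norm_bound_integral)
    fix t :: real assume t: "t \<in> {0..1}"
    have "0 \<le> t powr (a - 1) * (1 - t) powr (b - 1) / Beta a b"
      using Beta_pos by simp
    then show "norm (t powr (a - 1) * (1 - t) powr (b - 1) / Beta a b * f t)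
        \<le> t powr (a - 1) * (1 - t) powr (b - 1) / Beta a b * g t"
      using assms(3)[OF t] unfolding real_norm_def abs_mult by (intro mult_mono) auto
  qed (intro beta_weight_integrable assms)+
  then show ?thesis by simp
qed

lemma beta_mean_moments:
  "beta_mean a b (\<lambda>t. 1) = 1"
  "beta_mean a b (\<lambda>t. t) = a / (a + b)"
  "beta_mean a b Psi = a * b / ((a + b) * (a + b + 1))"
proof -
  \<comment> \<open>Multiplying the density by \<open>f\<close> shifts the parameters to
    \<open>c\<close> and \<open>d\<close>, so the mean is a quotient of Beta values, evaluated by
    the recurrences \<open>B1\<close> and \<open>B2\<close>.\<close>
  have *: "beta_mean a b f = Beta c d / Beta a b"
    if "c > 0" "d > 0" and
      "\<And>t. t \<in> {0..1} \<Longrightarrow> t powr (a - 1) * (1 - t) powr (b - 1) * f t = t powr (c - 1) * (1 - t) powr (d - 1)"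
    for f :: "real \<Rightarrow> real" and c d
  proof -
    have "((\<lambda>t. t powr (c - 1) * (1 - t) powr (d - 1) / Beta a b) has_integral Beta c d / Beta a b) {0..1}"
      by (intro has_integral_divide has_integral_Beta_real that)
    then have "((\<lambda>t. t powr (a - 1) * (1 - t) powr (b - 1) / Beta a b * f t) has_integral Beta c d / Beta a b) {0..1}"
      by (rule has_integral_eq[rotated]) (use that(3) in simp)
    then show ?thesis unfolding beta_mean_def by (rule integral_unique)
  qed
  have pt: "t powr (a - 1) * t = t powr a" if "0 \<le> t" for t :: real
    using powr_mult_base[OF that, of "a - 1"] by (simp add: mult.commute)
  have p1: "(1 - t) powr (b - 1) * (1 - t) = (1 - t) powr b" if "t \<le> 1" for t :: real
    using powr_mult_base[of "1 - t" "b - 1"] that by (simp add: mult.commute)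
  have np: "a \<notin> \<int>\<^sub>\<le>\<^sub>0" "b \<notin> \<int>\<^sub>\<le>\<^sub>0"
    using ab by (auto elim!: nonpos_Ints_cases)
  have B1: "Beta (a + 1) b = a / (a + b) * Beta a b"
    using Beta_plus1_left[OF np(1), of b] ab by (simp add: field_simps)
  have "(a + 1 + b) * Beta (a + 1) (b + 1) = b * Beta (a + 1) b"
    by (rule Beta_plus1_right[OF np(2)])
  then have B2: "Beta (a + 1) (b + 1) = b / (a + b + 1) * Beta (a + 1) b"
    using ab by (simp add: field_simps)
  show "beta_mean a b (\<lambda>t. 1) = 1"
    using *[of a b "\<lambda>t. 1"] ab Beta_pos by simp
  show "beta_mean a b (\<lambda>t. t) = a / (a + b)"
  proof -
    have "t powr (a - 1) * (1 - t) powr (b - 1) * t = t powr a * (1 - t) powr (b - 1)" if "t \<in> {0..1}" for t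
    proof -
      have "t powr (a - 1) * (1 - t) powr (b - 1) * t = (t powr (a - 1) * t) * (1 - t) powr (b - 1)"
        by simp
      then show ?thesis using pt that by simp
    qed
    then have "beta_mean a b (\<lambda>t. t) = Beta (a + 1) b / Beta a b"
      using ab by (intro *) auto
    then show ?thesis using Beta_pos B1 by simp
  qed
  show "beta_mean a b Psi = a * b / ((a + b) * (a + b + 1))"
  proof -
    have "t powr (a - 1) * (1 - t) powr (b - 1) * Psi t = t powr a * (1 - t) powr b" if "t \<in> {0..1}" for t
    proof -
      have "t powr (a - 1) * (1 - t) powr (b - 1) * Psi t = (t powr (a - 1) * t) * ((1 - t) powr (b - 1) * (1 - t))"
        by (simp add: Psi_def)
      then show ?thesis using pt[of t] p1[of t] that by (simp only: atLeastAtMost_iff)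
    qed
    then have "beta_mean a b Psi = Beta (a + 1) (b + 1) / Beta a b"
      using ab by (intro *) auto
    also have "\<dots> = b / (a + b + 1) * (a / (a + b) * Beta a b) / Beta a b"
      by (simp only: B1 B2)
    also have "\<dots> = a * b / ((a + b) * (a + b + 1))"
      using Beta_pos by (simp add: mult_ac)
    finally show ?thesis .
  qed
qed

text \<open>With the mean m, (t - m)^2 = (1 - 2 m) t + m^2 - Psi t, so the moments of 1, t and
  \<open>Psi\<close> determine the variance.\<close>

lemma beta_mean_variance:
  "beta_mean a b (\<lambda>t. (t - a / (a + b))\<^sup>2) = Psi (a / (a + b)) / (a + b + 1)"
proof -
  define m where "m = a / (a + b)"
  have "beta_mean a b (\<lambda>t. (t - m)\<^sup>2) = beta_mean a b (\<lambda>t. 1 * ((1 - 2 * m) * t + m\<^sup>2 * 1) + (-1) * Psi t)"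
    unfolding Psi_def by (rule arg_cong[where f = "beta_mean a b"]) (auto simp: power2_eq_square algebra_simps)
  also have "\<dots> = 1 * ((1 - 2 * m) * m + m\<^sup>2 * 1) + (-1) * (a * b / ((a + b) * (a + b + 1)))"
    by (subst beta_mean_linear, (intro continuous_intros)+, subst beta_mean_linear, (intro continuous_intros)+)
      (simp add: beta_mean_moments m_def)
  also have "\<dots> = Psi m - a * b / ((a + b) * (a + b + 1))"
    by (simp add: Psi_def power2_eq_square algebra_simps)
  also have "a * b / ((a + b) * (a + b + 1)) = Psi m * ((a + b) / (a + b + 1))"
  proof -
    have "1 - m = b / (a + b)" using ab by (simp add: m_def field_simps)
    then have "Psi m = a * b / (a + b)\<^sup>2" by (simp add: Psi_def m_def power2_eq_square)
    then show ?thesis using ab by (simp add: power2_eq_square)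
  qed
  also have "Psi m - Psi m * ((a + b) / (a + b + 1)) = Psi m / (a + b + 1)"
    using ab by (simp add: field_simps)
  finally show ?thesis by (simp add: m_def)
qed

end

text \<open>Korovkin's device: continuity controls \<open>g\<close> near \<open>x\<close>,
  boundedness and the quadratic term control it elsewhere, so convergence of means reduces to their
  variance.\<close>

lemma continuous_quadratic_majorant:
  fixes g :: "real \<Rightarrow> real"
  assumes g: "continuous_on {0..1} g" and x: "x \<in> {0..1}" and e: "0 < e"
  obtains M where "0 \<le> M" "\<And>t. t \<in> {0..1} \<Longrightarrow> \<bar>g t - g x\<bar> \<le> e + M * (t - x)\<^sup>2"
proof -
  have "bounded (g ` {0..1})"
    by (intro compact_imp_bounded compact_continuous_image g) auto
  then obtain B where B: "\<forall>x\<in>{0..1}. \<bar>g x\<bar> \<le> B" unfolding bounded_iff by auto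
  then have B0: "0 \<le> B" by force
  obtain d where d: "d > 0" "\<And>t. t \<in> {0..1} \<Longrightarrow> \<bar>t - x\<bar> < d \<Longrightarrow> \<bar>g t - g x\<bar> < e"
    using g x e unfolding continuous_on_iff dist_real_def by metis
  show ?thesis
  \<comment> \<open>Any two values of \<open>g\<close> differ by at most 2 B, and (t - x)^2 / d^2 >=
    1 as soon as |t - x| >= d.\<close>
  proof (rule that[of "2 * B / d\<^sup>2"])
    show "0 \<le> 2 * B / d\<^sup>2" using B0 by simp
    fix t :: real assume t: "t \<in> {0..1}"
    show "\<bar>g t - g x\<bar> \<le> e + 2 * B / d\<^sup>2 * (t - x)\<^sup>2"
    proof (cases "\<bar>t - x\<bar> < d")
      case True
      then show ?thesis using d(2)[OF t] B0 by (intro add_increasing2) auto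
    next
      case False
      have "d\<^sup>2 \<le> \<bar>t - x\<bar>\<^sup>2" by (rule power_mono) (use False d in auto)
      then have "2 * B * 1 \<le> 2 * B * ((t - x)\<^sup>2 / d\<^sup>2)"
        using B0 d by (intro mult_left_mono) auto
      moreover have "\<bar>g t - g x\<bar> \<le> 2 * B" using bspec[OF B t] bspec[OF B x] by linarith
      ultimately show ?thesis using e by simp
    qed
  qed
qed

text \<open>Scaling both parameters by \<rho> keeps the mean x = p / (p + q) fixed, while the
  variance Psi x / ((p + q) \<rho> + 1) tends to 0.\<close>

lemma beta_mean_tendsto:
  assumes g: "continuous_on {0..1} g" and pq: "0 < p" "0 < q"
  shows "((\<lambda>\<rho>. beta_mean (p * \<rho>) (q * \<rho>) g) \<longlongrightarrow> g (p / (p + q))) at_top"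
proof -
  define x where "x = p / (p + q)"
  have x: "x \<in> {0..1}" using pq by (simp add: x_def)
  have mean: "p * \<rho> / (p * \<rho> + q * \<rho>) = x" if "0 < \<rho>" for \<rho>
    using that by (simp add: x_def distrib_right[symmetric])
  have "\<forall>\<^sub>F \<rho> in at_top. \<bar>beta_mean (p * \<rho>) (q * \<rho>) g - g x\<bar> < e" if e: "0 < e" for e
  proof -
    obtain M where M: "0 \<le> M" "\<And>t. t \<in> {0..1} \<Longrightarrow> \<bar>g t - g x\<bar> \<le> e / 2 + M * (t - x)\<^sup>2"
      using continuous_quadratic_majorant[OF g x, of "e / 2"] e by (metis half_gt_zero)
    have "((\<lambda>\<rho>. M * (Psi x / (p * \<rho> + q * \<rho> + 1))) \<longlongrightarrow> M * 0) at_top"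
    proof (intro tendsto_mult tendsto_const tendsto_divide_0[OF tendsto_const] filterlim_at_top_imp_at_infinity)
      have "filterlim (\<lambda>\<rho>. 1 + (p + q) * \<rho>) at_top at_top"
        by (intro filterlim_tendsto_add_at_top[OF tendsto_const]
            filterlim_tendsto_pos_mult_at_top[OF tendsto_const] filterlim_ident) (use pq in auto)
      then show "filterlim (\<lambda>\<rho>. p * \<rho> + q * \<rho> + 1) at_top at_top"
        by (simp add: algebra_simps)
    qed
    then have "\<forall>\<^sub>F \<rho> in at_top. M * (Psi x / (p * \<rho> + q * \<rho> + 1)) < e / 2"
      using e by (intro order_tendstoD) auto
    with eventually_gt_at_top[of "0::real"] show ?thesis
    proof eventually_elim
      case (elim \<rho>)
      define a b where "a = p * \<rho>" and "b = q * \<rho>"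
      have ab: "0 < a" "0 < b" using pq elim by (auto simp: a_def b_def)
      have m: "a / (a + b) = x" using mean[OF elim(1)] by (simp add: a_def b_def)
      have "beta_mean a b g - g x = beta_mean a b (\<lambda>t. 1 * g t + (- g x) * 1)"
        using beta_mean_linear[OF ab g, of "\<lambda>t. 1" 1 "- g x"] beta_mean_moments(1)[OF ab] by simp
      also have "\<bar>\<dots>\<bar> \<le> beta_mean a b (\<lambda>t. (e / 2) * 1 + M * (t - x)\<^sup>2)"
        by (rule beta_mean_bound[OF ab]) (use M g in \<open>auto intro!: continuous_intros\<close>)
      also have "\<dots> = e / 2 + M * (Psi x / (a + b + 1))"
        using beta_mean_linear[OF ab, of "\<lambda>t. 1" "\<lambda>t. (t - x)\<^sup>2" "e / 2" M] beta_mean_moments(1)[OF ab]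
          beta_mean_variance[OF ab] m by (simp add: continuous_intros)
      also have "\<dots> < e" using elim unfolding a_def b_def by linarith
      finally show ?case by (simp add: a_def b_def)
    qed
  qed
  then show ?thesis unfolding x_def[symmetric] by (intro tendstoI) (simp add: dist_real_def)
qed

lemma U_op_eq:
  "f 0 = 0 \<Longrightarrow> f 1 = 0 \<Longrightarrow>
    U_op n \<rho> f x = (\<Sum>k=1..n-1. beta_mean (real k * \<rho>) (real (n - k) * \<rho>) f * Bernstein n k x)"
  by (simp add: U_op_def beta_mean_def)

text \<open>The Beta mean of \<open>Psi\<close> with parameters k \<rho> and (n - k) \<rho> is
  \<open>Psi (k / n)\<close> times n \<rho> / (n \<rho> + 1), a ratio that does not depend on
  k.\<close>

lemma Psi_contraction_U_op:
  assumes n: "n \<ge> 1" and \<rho>: "0 < \<rho>"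
  shows "Psi_contraction (U_op n \<rho>) (real n * \<rho> / (real n * \<rho> + 1) * (1 - 1 / real n))"
proof (rule Psi_contraction_Bernstein_form[where l = "\<lambda>k. beta_mean (real k * \<rho>) (real (n - k) * \<rho>)"])
  have pos: "0 < real k * \<rho>" "0 < real (n - k) * \<rho>" if "k \<in> {1..n-1}" for k
    using that \<rho> by auto
  show "U_op n \<rho> f x = (\<Sum>k=1..n-1. beta_mean (real k * \<rho>) (real (n - k) * \<rho>) f * Bernstein n k x)"
    if "f \<in> C0" for f x using C0_endpoints[OF that] by (simp add: U_op_eq)
  show "beta_mean (real k * \<rho>) (real (n - k) * \<rho>) (\<lambda>t. a * f t + b * g t) =
      a * beta_mean (real k * \<rho>) (real (n - k) * \<rho>) f + b * beta_mean (real k * \<rho>) (real (n - k) * \<rho>) g"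
    if "k \<in> {1..n-1}" "f \<in> C0" "g \<in> C0" for k f g a b
    using that by (intro beta_mean_linear pos C0_continuous)
  show "\<bar>beta_mean (real k * \<rho>) (real (n - k) * \<rho>) f\<bar>
      \<le> c * (real n * \<rho> / (real n * \<rho> + 1) * Psi (real k / real n))"
    if k: "k \<in> {1..n-1}" and f: "f \<in> C0" and c: "\<And>x. x \<in> {0..1} \<Longrightarrow> \<bar>f x\<bar> \<le> c * Psi x" for k f c
  proof -
    have "\<bar>beta_mean (real k * \<rho>) (real (n - k) * \<rho>) f\<bar> \<le>
        beta_mean (real k * \<rho>) (real (n - k) * \<rho>) (\<lambda>t. c * Psi t + 0 * Psi t)"
      by (rule beta_mean_bound[OF pos[OF k] C0_continuous[OF f]]) (use c in \<open>auto intro!: continuous_intros\<close>)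
    also have "\<dots> = c * (real k * \<rho> * (real (n - k) * \<rho>) /
        ((real k * \<rho> + real (n - k) * \<rho>) * (real k * \<rho> + real (n - k) * \<rho> + 1)))"
      by (subst beta_mean_linear[OF pos[OF k]])
        (auto intro!: continuous_intros simp: beta_mean_moments(3)[OF pos[OF k]])
    also have "real k * \<rho> + real (n - k) * \<rho> = real n * \<rho>"
      by (simp only: distrib_right[symmetric] node_add[OF k])
    also have "real k * \<rho> * (real (n - k) * \<rho>) / (real n * \<rho> * (real n * \<rho> + 1)) =
        real n * \<rho> / (real n * \<rho> + 1) * Psi (real k / real n)"
    proof -
      have "Psi (real k / real n) = real k * real (n - k) / (real n)\<^sup>2"
        using node_add[OF k] n by (simp add: Psi_def field_simps power2_eq_square)
      moreover have "real n \<noteq> 0" using n by simp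
      ultimately show ?thesis using \<rho> by (simp add: power2_eq_square mult_ac)
    qed
    finally show ?thesis .
  qed
  have "0 \<le> real n * \<rho>" using \<rho> by simp
  then show "0 \<le> real n * \<rho> / (real n * \<rho> + 1)" "real n * \<rho> / (real n * \<rho> + 1) \<le> 1"
    by (auto simp: divide_le_eq)
qed (rule n)

lemma power_series_U_op_tendsto:
  assumes f: "f \<in> C0" and x: "x \<in> {0..1}" and n: "n \<ge> 1"
  shows "((\<lambda>\<rho>. power_series_op (U_op n \<rho>) f x) \<longlongrightarrow> power_series_op (bernstein_op n) f x) at_top"
proof -
  define G where "G = power_series_op (bernstein_op n) f"
  note B = Psi_contraction_bernstein_op[OF n]
  have G: "G \<in> C0" unfolding G_def by (rule power_series_op_C0[OF B f])
  have Gfix: "G t = f t + bernstein_op n G t" if "t \<in> {0..1}" for t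
    unfolding G_def by (rule power_series_op_fixpoint[OF B f that])
  \<comment> \<open>The binomial weights come from \<open>Bernstein_le_Psi\<close>; thus
    \<open>r \<rho>\<close> bounds the residual relative to \<open>Psi\<close> at every point
    simultaneously.\<close>
  define r where "r \<rho> = (\<Sum>k=1..n-1. \<bar>beta_mean (real k * \<rho>) (real (n - k) * \<rho>) G - G (real k / real n)\<bar>
      * real (n choose k))" for \<rho>
  have "(r \<longlongrightarrow> (\<Sum>k=1..n-1. \<bar>G (real k / real n) - G (real k / real n)\<bar> * real (n choose k))) at_top"
    unfolding r_def[abs_def]
  proof (intro tendsto_sum tendsto_mult tendsto_rabs tendsto_diff tendsto_const)
    fix k assume k: "k \<in> {1..n-1}"
    have "real k / (real k + real (n - k)) = real k / real n" by (simp only: node_add[OF k])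
    moreover have "0 < real k" "0 < real (n - k)" using k by auto
    ultimately show "((\<lambda>\<rho>. beta_mean (real k * \<rho>) (real (n - k) * \<rho>) G) \<longlongrightarrow> G (real k / real n)) at_top"
      using beta_mean_tendsto[OF C0_continuous[OF G], of "real k" "real (n - k)"] by simp
  qed
  then have r0: "(r \<longlongrightarrow> 0) at_top" by simp
  have "\<bar>power_series_op (U_op n \<rho>) f x - G x\<bar> \<le> real n * r \<rho> * Psi x" if \<rho>: "0 < \<rho>" for \<rho>
  proof -
    note U = Psi_contraction_U_op[OF n \<rho>]
    define S where "S = power_series_op (U_op n \<rho>) f"
    have S: "S \<in> C0" unfolding S_def by (rule power_series_op_C0[OF U f])
    have Sfix: "S t = f t + U_op n \<rho> S t" if "t \<in> {0..1}" for t
      unfolding S_def by (rule power_series_op_fixpoint[OF U f that])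
    define e where "e = (\<lambda>t. S t - G t)"
    have e: "e \<in> C0" unfolding e_def by (rule C0_diff[OF S G])
    let ?\<gamma> = "real n * \<rho> / (real n * \<rho> + 1) * (1 - 1 / real n)"
    have res: "\<bar>e t - U_op n \<rho> e t\<bar> \<le> r \<rho> * Psi t" if t: "t \<in> {0..1}" for t
    proof -
      \<comment> \<open>Subtracting the two fixed-point equations cancels \<open>f\<close> and
        removes the \<rho>-dependent function \<open>S\<close> from the residual.\<close>
      have "e t - U_op n \<rho> e t = U_op n \<rho> G t - bernstein_op n G t"
        using contraction_diff[OF U S G t] Sfix[OF t] Gfix[OF t] by (simp add: e_def)
      also have "\<dots> = (\<Sum>k=1..n-1. (beta_mean (real k * \<rho>) (real (n - k) * \<rho>) G - G (real k / real n))
          * Bernstein n k t)"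
        using C0_endpoints[OF G] n
        by (simp add: U_op_eq bernstein_op_interior sum_subtractf left_diff_distrib)
      also have "\<bar>\<dots>\<bar> \<le> (\<Sum>k=1..n-1. \<bar>(beta_mean (real k * \<rho>) (real (n - k) * \<rho>) G - G (real k / real n))
          * Bernstein n k t\<bar>)"
        by (rule sum_abs)
      also have "\<dots> \<le> (\<Sum>k=1..n-1. \<bar>beta_mean (real k * \<rho>) (real (n - k) * \<rho>) G - G (real k / real n)\<bar>
          * (real (n choose k) * Psi t))"
      proof (rule sum_mono)
        fix k assume "k \<in> {1..n-1}"
        from Bernstein_le_Psi[OF this t]
        have "\<bar>Bernstein n k t\<bar> \<le> real (n choose k) * Psi t"
          using Bernstein_nonneg_Icc[OF t] by simp
        then show "\<bar>(beta_mean (real k * \<rho>) (real (n - k) * \<rho>) G - G (real k / real n)) * Bernstein n k t\<bar>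
            \<le> \<bar>beta_mean (real k * \<rho>) (real (n - k) * \<rho>) G - G (real k / real n)\<bar>
                * (real (n choose k) * Psi t)"
          unfolding abs_mult by (rule mult_left_mono) simp
      qed
      also have "\<dots> = r \<rho> * Psi t" by (simp add: r_def sum_distrib_right mult.assoc)
      finally show ?thesis .
    qed
    have r_nonneg: "0 \<le> r \<rho>" by (simp add: r_def sum_nonneg)
    have "\<bar>e x\<bar> \<le> r \<rho> / (1 - ?\<gamma>) * Psi x"
      by (rule Psi_residual_bound[where Td = "U_op n \<rho> e" and C = "norm0 e", OF _ contraction_factor[OF U]])
        (use contraction_bound[OF U e] norm0_bounds(2)[OF e] res x in auto)
    also have "\<dots> \<le> real n * r \<rho> * Psi x"
    proof (intro mult_right_mono Psi_nonneg x)
      have "?\<gamma> \<le> 1 * (1 - 1 / real n)"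
        using n \<rho> by (intro mult_right_mono) (auto simp: divide_le_eq add_pos_nonneg)
      then have "1 / real n \<le> 1 - ?\<gamma>" by simp
      then have "r \<rho> / (1 - ?\<gamma>) \<le> r \<rho> / (1 / real n)"
        using n r_nonneg contraction_factor[OF U] by (intro divide_left_mono) auto
      then show "r \<rho> / (1 - ?\<gamma>) \<le> real n * r \<rho>" by (simp add: mult.commute)
    qed
    finally show ?thesis by (simp add: e_def S_def)
  qed
  then have "\<forall>\<^sub>F \<rho> in at_top. norm (power_series_op (U_op n \<rho>) f x - G x) \<le> real n * r \<rho> * Psi x"
    by (intro eventually_mono[OF eventually_gt_at_top[of "0::real"]]) simp
  moreover have "((\<lambda>\<rho>. real n * r \<rho> * Psi x) \<longlongrightarrow> 0) at_top"
    using tendsto_mult[OF tendsto_mult[OF tendsto_const r0] tendsto_const, of "real n" "Psi x"] by simp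
  ultimately have "((\<lambda>\<rho>. power_series_op (U_op n \<rho>) f x - G x) \<longlongrightarrow> 0) at_top"
    by (rule Lim_null_comparison)
  then show ?thesis unfolding G_def by (rule LIM_zero_cancel)
qed

section \<open>The inverse differential operator\<close>

lemma has_real_derivative_deriv01:
  assumes "y differentiable_on {0..1}" "x \<in> {0..1}"
  shows "(y has_real_derivative deriv01 y x) (at x within {0..1})"
  using assms unfolding deriv01_def differentiable_on_def
  by (simp add: has_real_derivative_iff_has_vector_derivative vector_derivative_works[symmetric])

lemma deriv01_eq:
  assumes "(y has_real_derivative y') (at x within {0..1})" "x \<in> {0..1}"
  shows "deriv01 y x = y'"
  using vector_derivative_within_closed_interval[of 0 1 x y y'] assms
  by (simp add: deriv01_def has_real_derivative_iff_has_vector_derivative)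

lemma
  assumes y1: "\<And>x. x \<in> {0..1} \<Longrightarrow> (y has_real_derivative y' x) (at x within {0..1})"
    and y2: "\<And>x. x \<in> {0..1} \<Longrightarrow> (y' has_real_derivative y'' x) (at x within {0..1})"
  shows deriv01_deriv01_eq: "x \<in> {0..1} \<Longrightarrow> deriv01 (deriv01 y) x = y'' x"
    and C2_zeroI: "continuous_on {0..1} y'' \<Longrightarrow> y 0 = 0 \<Longrightarrow> y 1 = 0 \<Longrightarrow> y \<in> C2_zero"
proof -
  have d: "(deriv01 y has_real_derivative y'' x) (at x within {0..1})" if "x \<in> {0..1}" for x
    by (rule has_field_derivative_transform_within[OF y2[OF that] zero_less_one that])
      (simp add: deriv01_eq[OF y1])
  show dd: "x \<in> {0..1} \<Longrightarrow> deriv01 (deriv01 y) x = y'' x" for x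
    using deriv01_eq[OF d] by simp
  have diff: "f differentiable_on {0..1}"
    if "\<And>x. x \<in> {0..1} \<Longrightarrow> (f has_real_derivative f' x) (at x within {0..1})" for f f' :: "real \<Rightarrow> real"
    using that unfolding differentiable_on_def real_differentiable_def by blast
  show "y \<in> C2_zero" if "continuous_on {0..1} y''" "y 0 = 0" "y 1 = 0"
    using that diff[OF y1] diff[OF d] continuous_on_cong[OF refl dd, of "{0..1}" "\<lambda>x. x"]
    by (simp add: C2_zero_def)
qed

text \<open>Equal second derivatives leave an affine difference, and this vanishes at both end
  points.\<close>

lemma C2_zero_unique:
  assumes y: "y \<in> C2_zero" and z: "z \<in> C2_zero"
    and eq: "\<And>x. x \<in> {0..1} \<Longrightarrow> deriv01 (deriv01 y) x = deriv01 (deriv01 z) x"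
    and x: "x \<in> {0..1}"
  shows "y x = z x"
proof -
  define d where "d t = y t - z t" for t
  define d' where "d' t = deriv01 y t - deriv01 z t" for t
  have 1: "(d has_real_derivative d' t) (at t within {0..1})" if "t \<in> {0..1}" for t
    unfolding d_def[abs_def] d'_def
    by (intro DERIV_diff has_real_derivative_deriv01 that) (use y z in \<open>auto simp: C2_zero_def\<close>)
  have 2: "(d' has_real_derivative 0) (at t within {0..1})" if "t \<in> {0..1}" for t
  proof -
    have "(d' has_real_derivative deriv01 (deriv01 y) t - deriv01 (deriv01 z) t) (at t within {0..1})"
      unfolding d'_def[abs_def]
      by (intro DERIV_diff has_real_derivative_deriv01 that) (use y z in \<open>auto simp: C2_zero_def\<close>)
    then show ?thesis using eq[OF that] by simp
  qed
  obtain c where c: "\<forall>t\<in>{0..1}. d' t = c"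
    using has_field_derivative_zero_constant[of "{0..1::real}" d'] 2 by auto
  have 3: "((\<lambda>t. d t - c * t) has_real_derivative 0) (at t within {0..1})" if "t \<in> {0..1}" for t
    using 1[OF that] bspec[OF c that] by (auto intro!: derivative_eq_intros)
  obtain b where b: "\<forall>t\<in>{0..1}. d t - c * t = b"
    using has_field_derivative_zero_constant[of "{0..1::real}" "\<lambda>t. d t - c * t"] 3 by auto
  have "d 0 = 0" "d 1 = 0" using y z by (auto simp: d_def C2_zero_def)
  with bspec[OF b, of 0] bspec[OF b, of 1] bspec[OF b x] have "d x = 0" by auto
  then show ?thesis by (simp add: d_def)
qed

lemma F_inf_endpoints: "F_inf h 0 = 0" "F_inf h 1 = 0"
  by (simp_all add: F_inf_def)

context
  fixes h :: "real \<Rightarrow> real"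
  assumes h: "continuous_on {0..1} h"
begin

text \<open>\<open>F_inf\<close> is the Green's function integral for -F'' = h with zero boundary
  values: on differentiating, the two terms x (1 - x) h(x) cancel, and then -(1 - x) h(x) - x h(x)
  remains.\<close>

lemma F_inf_derivatives:
  assumes x: "x \<in> {0..1}"
  shows "(F_inf h has_real_derivative
           integral {x..1} (\<lambda>t. (1 - t) * h t) - integral {0..x} (\<lambda>t. t * h t)) (at x within {0..1})"
    and "((\<lambda>x. integral {x..1} (\<lambda>t. (1 - t) * h t) - integral {0..x} (\<lambda>t. t * h t))
           has_real_derivative - h x) (at x within {0..1})"
proof -
  have 1: "((\<lambda>x. integral {0..x} (\<lambda>t. t * h t)) has_real_derivative x * h x) (at x within {0..1})"
    by (rule integral_has_real_derivative[OF _ x]) (intro continuous_intros h)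
  have 2: "((\<lambda>x. integral {x..1} (\<lambda>t. (1 - t) * h t)) has_real_derivative - ((1 - x) * h x)) (at x within {0..1})"
    by (rule integral_has_real_derivative'[OF _ x]) (intro continuous_intros h)
  show "(F_inf h has_real_derivative
           integral {x..1} (\<lambda>t. (1 - t) * h t) - integral {0..x} (\<lambda>t. t * h t)) (at x within {0..1})"
    unfolding F_inf_def[abs_def]
    by (rule derivative_eq_intros 1 2 refl)+ (simp add: algebra_simps)
  show "((\<lambda>x. integral {x..1} (\<lambda>t. (1 - t) * h t) - integral {0..x} (\<lambda>t. t * h t))
           has_real_derivative - h x) (at x within {0..1})"
    by (rule derivative_eq_intros 1 2 refl)+ (simp add: algebra_simps)
qed

text \<open>Supplies the a priori multiple of \<open>Psi\<close> that
  \<open>Psi_residual_bound\<close> needs as its starting value. On its interval each weight, t or 1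
  - t, is at most its value at x.\<close>

lemma F_inf_bound: "\<exists>C. \<forall>x\<in>{0..1}. \<bar>F_inf h x\<bar> \<le> C * Psi x"
proof -
  have "bounded (h ` {0..1})"
    by (intro compact_imp_bounded compact_continuous_image h) auto
  then obtain M where M: "\<forall>x\<in>{0..1}. \<bar>h x\<bar> \<le> M" unfolding bounded_iff by auto
  then have M0: "0 \<le> M" by force
  have "\<bar>F_inf h x\<bar> \<le> (2 * M) * Psi x" if x: "x \<in> {0..1}" for x
  proof -
    have "norm (integral {0..x} (\<lambda>t. t * h t)) \<le> (x * M) * (x - 0)"
      using x M M0 by (intro integral_bound)
        (auto intro!: continuous_intros continuous_on_subset[OF h] mult_mono simp: abs_mult)
    also have "\<dots> \<le> x * M" using x M0 by (simp add: mult_left_le)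
    finally have 1: "\<bar>integral {0..x} (\<lambda>t. t * h t)\<bar> \<le> x * M" by simp
    have "norm (integral {x..1} (\<lambda>t. (1 - t) * h t)) \<le> ((1 - x) * M) * (1 - x)"
      using x M M0 by (intro integral_bound)
        (auto intro!: continuous_intros continuous_on_subset[OF h] mult_mono simp: abs_mult)
    also have "\<dots> \<le> (1 - x) * M" using x M0 by (simp add: mult_left_le)
    finally have 2: "\<bar>integral {x..1} (\<lambda>t. (1 - t) * h t)\<bar> \<le> (1 - x) * M" by simp
    have "\<bar>F_inf h x\<bar> \<le> \<bar>(1 - x) * integral {0..x} (\<lambda>t. t * h t)\<bar> + \<bar>x * integral {x..1} (\<lambda>t. (1 - t) * h t)\<bar>"
      unfolding F_inf_def by (rule abs_triangle_ineq)
    also have "\<dots> \<le> (1 - x) * (x * M) + x * ((1 - x) * M)"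
      unfolding abs_mult using 1 2 x by (intro add_mono mult_mono) auto
    also have "\<dots> = (2 * M) * Psi x" by (simp add: Psi_def algebra_simps)
    finally show ?thesis .
  qed
  then show ?thesis by blast
qed

lemma A_diff_inv_Psi_mult:
  assumes \<rho>: "0 < \<rho>" and x: "x \<in> {0..1}"
  shows "A_diff_inv \<rho> (\<lambda>t. Psi t * h t) x = - (2 * \<rho> / (\<rho> + 1)) * F_inf h x"
proof -
  define c where "c = - (2 * \<rho> / (\<rho> + 1))"
  define z where "z x = c * F_inf h x" for x
  define z' where "z' x = c * (integral {x..1} (\<lambda>t. (1 - t) * h t) - integral {0..x} (\<lambda>t. t * h t))" for x
  have z1: "(z has_real_derivative z' x) (at x within {0..1})" if "x \<in> {0..1}" for x
    unfolding z_def[abs_def] z'_def by (rule DERIV_cmult[OF F_inf_derivatives(1)[OF that]])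
  have z2: "(z' has_real_derivative c * - h x) (at x within {0..1})" if "x \<in> {0..1}" for x
    unfolding z'_def[abs_def] by (rule DERIV_cmult[OF F_inf_derivatives(2)[OF that]])
  have zC: "z \<in> C2_zero"
    by (rule C2_zeroI[OF z1 z2]) (auto intro!: continuous_intros h simp: z_def F_inf_endpoints)
  have ODE: "(\<rho> + 1) / (2 * \<rho>) * (c * - h x) = h x" for x
  proof -
    have "(\<rho> + 1) / (2 * \<rho>) * c = - 1" using \<rho> by (simp add: c_def)
    then show ?thesis by (metis minus_mult_minus mult.assoc mult_1)
  qed
  have zA: "A_diff \<rho> z x = Psi x * h x" if "x \<in> {0..1}" for x
  proof -
    have "A_diff \<rho> z x = Psi x * ((\<rho> + 1) / (2 * \<rho>) * (c * - h x))"
      using deriv01_deriv01_eq[OF z1 z2 that] by (simp only: A_diff_def Psi_def mult_ac)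
    then show ?thesis by (simp only: ODE)
  qed
  define y where "y = A_diff_inv \<rho> (\<lambda>t. Psi t * h t)"
  have y: "y \<in> C2_zero \<and> (\<forall>x\<in>{0..1}. A_diff \<rho> y x = Psi x * h x)"
    unfolding y_def A_diff_inv_def by (rule someI[of _ z]) (use zC zA in blast)
  have "y x = z x"
  proof (rule C2_zero_unique[OF _ zC _ x])
    show "y \<in> C2_zero" using y by blast
    fix t :: real assume t: "t \<in> {0..1}"
    \<comment> \<open>The differential equation determines only \<open>Psi\<close> times the second
      derivative; continuity of both second derivatives recovers the end points.\<close>
    show "deriv01 (deriv01 y) t = deriv01 (deriv01 z) t"
    proof (rule Psi_mult_cancel[OF _ _ _ t])
      show "continuous_on {0..1} (deriv01 (deriv01 y))" "continuous_on {0..1} (deriv01 (deriv01 z))"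
        using y zC by (auto simp: C2_zero_def)
      fix s :: real assume s: "s \<in> {0..1}"
      have "A_diff \<rho> y s = A_diff \<rho> z s" using y zA s by simp
      then show "Psi s * deriv01 (deriv01 y) s = Psi s * deriv01 (deriv01 z) s"
        using \<rho> by (simp add: A_diff_def Psi_def mult.assoc)
    qed
  qed
  then show ?thesis by (simp add: y_def z_def c_def)
qed

text \<open>\<open>Psi_quot\<close> recovers \<open>h\<close> on [0,1], and the integrals in
  \<open>F_inf\<close> do not look outside.\<close>

lemma A_diff_inv_inf_Psi_mult:
  assumes x: "x \<in> {0..1}"
  shows "A_diff_inv_inf (\<lambda>t. Psi t * h t) x = - (2 * F_inf h x)"
proof -
  have q: "Psi_quot (\<lambda>t. Psi t * h t) t = h t" if "t \<in> {0..1}" for t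
    by (rule Psi_quot_eq[OF h _ that]) simp
  have "integral {0..x} (\<lambda>t. t * Psi_quot (\<lambda>t. Psi t * h t) t) = integral {0..x} (\<lambda>t. t * h t)"
    "integral {x..1} (\<lambda>t. (1 - t) * Psi_quot (\<lambda>t. Psi t * h t) t) = integral {x..1} (\<lambda>t. (1 - t) * h t)"
    using x q by (auto intro!: integral_cong)
  then show ?thesis by (simp add: A_diff_inv_inf_def F_inf_def)
qed

end

section \<open>Local linear approximation and the Voronovskaya remainder\<close>

text \<open>First differences start at 4 w and grow by at most w per step, so the values grow
  quadratically. The starting constants 2 and 4 are those arising to the left of x in
  \<open>local_quadratic_growth\<close>.\<close>

lemma second_difference_growth:
  fixes a :: "nat \<Rightarrow> real"
  assumes "0 \<le> w" "\<bar>a 0\<bar> \<le> 2 * w" "K \<ge> 1 \<Longrightarrow> \<bar>a 1 - a 0\<bar> \<le> 4 * w"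
    and "\<And>k. k + 2 \<le> K \<Longrightarrow> \<bar>a (k + 2) - 2 * a (k + 1) + a k\<bar> \<le> w"
  shows "\<bar>a K\<bar> \<le> w * (2 + 4 * (real K)\<^sup>2)"
proof -
  have step: "k + 1 \<le> K \<Longrightarrow> \<bar>a (k + 1) - a k\<bar> \<le> w * (4 + real k)" for k
  proof (induction k)
    case 0 then show ?case using assms(3) by simp
  next
    case (Suc k)
    have "\<bar>a (k + 2) - a (k + 1)\<bar> \<le> \<bar>a (k + 2) - 2 * a (k + 1) + a k\<bar> + \<bar>a (k + 1) - a k\<bar>"
      by linarith
    also have "\<dots> \<le> w + w * (4 + real k)"
      using Suc assms(4)[of k] by (intro add_mono) auto
    finally show ?case by (simp add: algebra_simps)
  qed
  have "k \<le> K \<Longrightarrow> \<bar>a k\<bar> \<le> w * (2 + 4 * (real k)\<^sup>2)" for k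
  proof (induction k)
    case 0 then show ?case using assms(2) by simp
  next
    case (Suc k)
    have "\<bar>a (k + 1)\<bar> \<le> \<bar>a (k + 1) - a k\<bar> + \<bar>a k\<bar>" by linarith
    also have "\<dots> \<le> w * (4 + real k) + w * (2 + 4 * (real k)\<^sup>2)"
      using Suc step[of k] by (intro add_mono) auto
    also have "\<dots> = w * (6 + real k + 4 * (real k)\<^sup>2)" by (simp add: algebra_simps)
    also have "\<dots> \<le> w * (2 + 4 * (real (k + 1))\<^sup>2)"
      by (rule mult_left_mono[OF _ assms(1)]) (simp add: power2_eq_square algebra_simps)
    finally show ?case by simp
  qed
  then show ?thesis by simp
qed

text \<open>At a maximum point c of |g|, take the symmetric step to the nearer end: g vanishes there
  and |g| at the mirror point is at most |g c|, so 2 |g c| <= w + |g c|.\<close>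

lemma abs_le_second_difference_zero_ends:
  fixes g :: "real \<Rightarrow> real"
  assumes cont: "continuous_on {a..b} g" and ab: "a \<le> b" and g0: "g a = 0" "g b = 0"
    and w: "\<And>u s. 0 \<le> s \<Longrightarrow> a \<le> u - s \<Longrightarrow> u + s \<le> b \<Longrightarrow> \<bar>g (u + s) - 2 * g u + g (u - s)\<bar> \<le> w"
    and u: "u \<in> {a..b}"
  shows "\<bar>g u\<bar> \<le> w"
proof -
  have "\<exists>c\<in>{a..b}. \<forall>t\<in>{a..b}. \<bar>g t\<bar> \<le> \<bar>g c\<bar>"
    using ab by (intro continuous_attains_sup continuous_intros cont) auto
  then obtain c where c: "c \<in> {a..b}" "\<And>t. t \<in> {a..b} \<Longrightarrow> \<bar>g t\<bar> \<le> \<bar>g c\<bar>" by blast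
  have "\<bar>g c\<bar> \<le> w"
  proof (cases "c - a \<le> b - c")
    case True
    then show ?thesis using w[of "c - a" c] c(2)[of "c + (c - a)"] c(1) g0 by auto
  next
    case False
    then show ?thesis using w[of "b - c" c] c(2)[of "c - (b - c)"] c(1) g0 by auto
  qed
  then show ?thesis using c(2)[OF u] by linarith
qed

text \<open>Between its two zeros \<open>g\<close> is bounded by \<open>w\<close>; away from them the values along an arithmetic
  progression of step \<open>d\<close> have second differences at most \<open>w\<close>.\<close>

lemma local_quadratic_growth:
  fixes g :: "real \<Rightarrow> real"
  assumes cont: "continuous_on {0..1} g" and d: "0 < d" and x: "0 \<le> x" "x + d \<le> 1"
    and g0: "g x = 0" "g (x + d) = 0"
    and w: "\<And>u s. 0 \<le> s \<Longrightarrow> s \<le> d \<Longrightarrow> 0 \<le> u - s \<Longrightarrow> u + s \<le> 1 \<Longrightarrow>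
             \<bar>g (u + s) - 2 * g u + g (u - s)\<bar> \<le> w"
    and u: "u \<in> {0..1}"
  shows "\<bar>g u\<bar> \<le> w * (2 + 4 * ((u - x) / d)\<^sup>2)"
proof -
  have u1: "0 \<le> u" "u \<le> 1" using u by auto
  have w0: "0 \<le> w" using w[of 0 0] d by simp
  have base: "\<bar>g t\<bar> \<le> w" if "x \<le> t" "t \<le> x + d" for t
  proof (rule abs_le_second_difference_zero_ends[of x "x + d" g])
    show "continuous_on {x..x + d} g" by (rule continuous_on_subset[OF cont]) (use x in auto)
    show "\<bar>g (v + s) - 2 * g v + g (v - s)\<bar> \<le> w" if "0 \<le> s" "x \<le> v - s" "v + s \<le> x + d" for v s
      using that x by (intro w) auto
  qed (use that d g0 in auto)
  \<comment> \<open>Decomposes |u - x| = r + K d with 0 <= r < d: K full steps from a starting point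
    within one step of x.\<close>
  define q where "q = \<bar>u - x\<bar> / d"
  define K where "K = nat \<lfloor>q\<rfloor>"
  have q0: "0 \<le> q" using d by (simp add: q_def)
  have K: "real K \<le> q" "q < real K + 1" using q0 by (auto simp: K_def)
  define r where "r = \<bar>u - x\<bar> - real K * d"
  have qd: "q * d = \<bar>u - x\<bar>" using d by (simp add: q_def)
  have r: "0 \<le> r" "r < d"
    using mult_right_mono[OF K(1), of d] mult_strict_right_mono[OF K(2), of d] d
    unfolding qd by (auto simp: r_def distrib_right)
  have main: "\<bar>g u\<bar> \<le> w * (2 + 4 * (real K)\<^sup>2)"
  proof (cases "x \<le> u")
    case True
    then have u_eq: "u = x + r + real K * d" by (simp add: r_def)
    have "\<bar>(\<lambda>k. g (x + r + real k * d)) K\<bar> \<le> w * (2 + 4 * (real K)\<^sup>2)"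
    proof (rule second_difference_growth[OF w0])
      have "\<bar>g (x + r)\<bar> \<le> w" using base r by simp
      then show "\<bar>g (x + r + real 0 * d)\<bar> \<le> 2 * w" using w0 by simp
      show "\<bar>g (x + r + real 1 * d) - g (x + r + real 0 * d)\<bar> \<le> 4 * w" if "K \<ge> 1"
      proof -
        have "d \<le> real K * d" using that d by simp
        \<comment> \<open>Reflection in the zero x + d bounds g (x + d + r) by 2 w; subtracting g (x
          + r), itself at most w, stays below 4 w.\<close>
        then have "\<bar>g (x + d + r) - 2 * g (x + d) + g (x + d - r)\<bar> \<le> w"
          using r x u1 u_eq by (intro w; linarith)
        moreover have "\<bar>g (x + d - r)\<bar> \<le> w" "\<bar>g (x + r)\<bar> \<le> w" using base r by auto
        ultimately show ?thesis using g0 by (simp add: algebra_simps abs_le_iff)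
      qed
      show "\<bar>g (x + r + real (k + 2) * d) - 2 * g (x + r + real (k + 1) * d) + g (x + r + real k * d)\<bar> \<le> w"
        if "k + 2 \<le> K" for k
      proof -
        have "real (k + 2) * d \<le> real K * d" using that d by (intro mult_right_mono) auto
        then have "\<bar>g (x + r + real (k + 1) * d + d) - 2 * g (x + r + real (k + 1) * d)
                + g (x + r + real (k + 1) * d - d)\<bar> \<le> w"
          using d r x u1 u_eq by (intro w) (simp_all add: algebra_simps)
        then show ?thesis by (simp add: algebra_simps)
      qed
    qed
    then show ?thesis using u_eq by simp
  next
    case False
    then have u_eq: "u = x - r - real K * d" by (simp add: r_def)
    have Kd: "0 \<le> real K * d" using d by simp
    \<comment> \<open>The point x - r lies outside the interval between the zeros; reflecting it in
      the zero x costs one further w.\<close>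
    have a0: "\<bar>g (x - r)\<bar> \<le> 2 * w" and "\<bar>g (x + r) + g (x - r)\<bar> \<le> w"
    proof -
      have "r \<le> x" using u1 u_eq Kd by linarith
      then show *: "\<bar>g (x + r) + g (x - r)\<bar> \<le> w" using w[of r x] r x g0 by auto
      show "\<bar>g (x - r)\<bar> \<le> 2 * w" using * base[of "x + r"] r by auto
    qed
    have "\<bar>(\<lambda>k. g (x - r - real k * d)) K\<bar> \<le> w * (2 + 4 * (real K)\<^sup>2)"
    proof (rule second_difference_growth[OF w0])
      show "\<bar>g (x - r - real 0 * d)\<bar> \<le> 2 * w" using a0 by simp
      show "\<bar>g (x - r - real 1 * d) - g (x - r - real 0 * d)\<bar> \<le> 4 * w" if "K \<ge> 1"
      proof -
        have "d \<le> real K * d" using that d by simp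
        \<comment> \<open>The right neighbour x - r + d lies between the two zeros, so the first
          difference is at most w + 2 w + w.\<close>
        then have "\<bar>g (x - r + d) - 2 * g (x - r) + g (x - r - d)\<bar> \<le> w"
          using r x u1 u_eq d by (intro w; linarith)
        moreover have "\<bar>g (x - r + d)\<bar> \<le> w" using base[of "x - r + d"] r by auto
        ultimately show ?thesis using a0 by (simp add: algebra_simps abs_le_iff)
      qed
      show "\<bar>g (x - r - real (k + 2) * d) - 2 * g (x - r - real (k + 1) * d) + g (x - r - real k * d)\<bar> \<le> w"
        if "k + 2 \<le> K" for k
      proof -
        have "real (k + 2) * d \<le> real K * d" using that d by (intro mult_right_mono) auto
        moreover have "x \<le> 1 + (r + d * real k)" using x d r by (simp add: add_increasing2)
        ultimately have "\<bar>g (x - r - real (k + 1) * d + d) - 2 * g (x - r - real (k + 1) * d)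
                + g (x - r - real (k + 1) * d - d)\<bar> \<le> w"
          using d r x u1 u_eq by (intro w) (simp_all add: algebra_simps)
        then show ?thesis by (simp add: algebra_simps)
      qed
    qed
    then show ?thesis using u_eq by simp
  qed
  have "(real K)\<^sup>2 \<le> q\<^sup>2" by (rule power_mono[OF K(1)]) simp
  also have "q\<^sup>2 = ((u - x) / d)\<^sup>2" by (simp add: q_def power_divide)
  finally have "w * (2 + 4 * (real K)\<^sup>2) \<le> w * (2 + 4 * ((u - x) / d)\<^sup>2)"
    by (intro mult_left_mono w0) simp
  with main show ?thesis by linarith
qed

section \<open>Local replacement of h by a line\<close>

lemma modulus1_upper:
  assumes "continuous_on {0..1} h" "x \<in> {0..1}" "y \<in> {0..1}" "\<bar>x - y\<bar> \<le> d"
  shows "\<bar>h x - h y\<bar> \<le> modulus1 h d"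
proof -
  have "bounded (h ` {0..1})"
    by (intro compact_imp_bounded compact_continuous_image assms) auto
  then obtain M where M: "\<forall>x\<in>{0..1}. \<bar>h x\<bar> \<le> M" unfolding bounded_iff by auto
  have le: "\<bar>h u - h v\<bar> \<le> M + M" if "u \<in> {0..1}" "v \<in> {0..1}" for u v
    using bspec[OF M that(1)] bspec[OF M that(2)] by linarith
  show ?thesis unfolding modulus1_def
    by (rule cSup_upper) (use assms le in \<open>auto intro!: bdd_aboveI[where M = "M + M"]\<close>)
qed

lemma modulus2_upper:
  assumes "continuous_on {0..1} h" "0 \<le> s" "s \<le> d" "0 \<le> x - s" "x + s \<le> 1"
  shows "\<bar>h (x + s) - 2 * h x + h (x - s)\<bar> \<le> modulus2 h d"
proof -
  have "bounded (h ` {0..1})"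
    by (intro compact_imp_bounded compact_continuous_image assms) auto
  then obtain M where M: "\<forall>x\<in>{0..1}. \<bar>h x\<bar> \<le> M" unfolding bounded_iff by auto
  have le: "\<bar>h (u + t) - 2 * h u + h (u - t)\<bar> \<le> 4 * M"
    if "0 \<le> t" "u + t \<in> {0..1}" "u - t \<in> {0..1}" for u t
  proof -
    have u: "u \<in> {0..1}" using that by auto
    show ?thesis using bspec[OF M u] bspec[OF M that(2)] bspec[OF M that(3)] by linarith
  qed
  have "\<bar>h (x + s) - 2 * h x + h (x - s)\<bar> \<in> {\<bar>h (x + s) - 2 * h x + h (x - s)\<bar> | x s.
     0 \<le> s \<and> s \<le> d \<and> x + s \<in> {0..1} \<and> x - s \<in> {0..1}}"
    using assms by (intro CollectI exI[of _ x] exI[of _ s]) simp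
  then show ?thesis unfolding modulus2_def
    by (rule cSup_upper) (use le in \<open>auto intro!: bdd_aboveI[where M = "4 * M"]\<close>)
qed

text \<open>Subtracting the chord through x and x + d produces the two zeros required by
  \<open>local_quadratic_growth\<close> and leaves second differences unchanged.\<close>

lemma local_slope_left:
  fixes h :: "real \<Rightarrow> real"
  assumes cont: "continuous_on {0..1} h" and d: "0 < d" and x: "0 \<le> x" "x + d \<le> 1"
    and w: "\<And>u s. 0 \<le> s \<Longrightarrow> s \<le> d \<Longrightarrow> 0 \<le> u - s \<Longrightarrow> u + s \<le> 1 \<Longrightarrow>
             \<bar>h (u + s) - 2 * h u + h (u - s)\<bar> \<le> w"
    and u: "u \<in> {0..1}"
  shows "\<bar>h u - h x - (h (x + d) - h x) / d * (u - x)\<bar> \<le> w * (2 + 4 * ((u - x) / d)\<^sup>2)"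
proof -
  define m where "m = (h (x + d) - h x) / d"
  have "\<bar>(\<lambda>u. h u - h x - m * (u - x)) u\<bar> \<le> w * (2 + 4 * ((u - x) / d)\<^sup>2)"
  proof (rule local_quadratic_growth[OF _ d x])
    show "\<bar>h (v + s) - h x - m * (v + s - x) - 2 * (h v - h x - m * (v - x)) + (h (v - s) - h x - m * (v - s - x))\<bar> \<le> w"
      if "0 \<le> s" "s \<le> d" "0 \<le> v - s" "v + s \<le> 1" for v s
      using w[OF that] by (simp add: algebra_simps)
  qed (use d u in \<open>auto intro!: continuous_intros cont simp: m_def\<close>)
  then show ?thesis by (simp add: m_def)
qed

text \<open>The chord has to stay inside [0,1]. As d <= 1/2, it goes to x + d for x <= 1/2;
  otherwise it goes to x - d, reduced to the first case by the reflection t -> 1 - t.\<close>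

lemma local_slope:
  fixes h :: "real \<Rightarrow> real"
  assumes cont: "continuous_on {0..1} h" and d: "0 < d" "d \<le> 1 / 2" and x: "x \<in> {0..1}"
  obtains m where "\<bar>m\<bar> \<le> modulus1 h d / d"
    and "\<And>u. u \<in> {0..1} \<Longrightarrow> \<bar>h u - h x - m * (u - x)\<bar> \<le> modulus2 h d * (2 + 4 * ((u - x) / d)\<^sup>2)"
proof (cases "x \<le> 1 / 2")
  case True
  show ?thesis
  proof (rule that[of "(h (x + d) - h x) / d"])
    show "\<bar>(h (x + d) - h x) / d\<bar> \<le> modulus1 h d / d"
      using d x True modulus1_upper[OF cont, of "x + d" x d] by (simp add: divide_right_mono)
    show "\<bar>h u - h x - (h (x + d) - h x) / d * (u - x)\<bar> \<le> modulus2 h d * (2 + 4 * ((u - x) / d)\<^sup>2)"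
      if "u \<in> {0..1}" for u
      using d x True by (intro local_slope_left[OF cont d(1) _ _ modulus2_upper[OF cont] that]) auto
  qed
next
  case False
  show ?thesis
  proof (rule that[of "(h x - h (x - d)) / d"])
    show "\<bar>(h x - h (x - d)) / d\<bar> \<le> modulus1 h d / d"
      using d x False modulus1_upper[OF cont, of x "x - d" d] by (simp add: divide_right_mono)
    fix u :: real assume u: "u \<in> {0..1}"
    define k where "k t = h (1 - t)" for t
    have ck: "continuous_on {0..1} k"
      unfolding k_def[abs_def] by (rule continuous_on_compose2[OF cont]) (auto intro!: continuous_intros)
    have "\<bar>k (1 - u) - k (1 - x) - (k (1 - x + d) - k (1 - x)) / d * (1 - u - (1 - x))\<bar>
            \<le> modulus2 h d * (2 + 4 * ((1 - u - (1 - x)) / d)\<^sup>2)"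
    proof (rule local_slope_left[OF ck d(1)])
      show "\<bar>k (v + s) - 2 * k v + k (v - s)\<bar> \<le> modulus2 h d"
        if "0 \<le> s" "s \<le> d" "0 \<le> v - s" "v + s \<le> 1" for v s
        using modulus2_upper[OF cont that(1,2), of "1 - v"] that by (simp add: k_def algebra_simps)
    qed (use d x u False in auto)
    moreover have "(k (1 - x + d) - k (1 - x)) / d * (1 - u - (1 - x)) = (h x - h (x - d)) / d * (u - x)"
      unfolding k_def by (simp add: minus_divide_left[symmetric] algebra_simps diff_divide_distrib)
    moreover have "((1 - u - (1 - x)) / d)\<^sup>2 = ((u - x) / d)\<^sup>2"
      by (simp add: power_divide power2_commute)
    moreover have "k (1 - u) = h u" "k (1 - x) = h x" by (simp_all add: k_def)
    ultimately show "\<bar>h u - h x - (h x - h (x - d)) / d * (u - x)\<bar> \<le> modulus2 h d * (2 + 4 * ((u - x) / d)\<^sup>2)"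
      by (simp only:)
  qed
qed

section \<open>Integrating the local bound twice\<close>

lemma nonneg_of_second_derivative_nonneg:
  fixes f :: "real \<Rightarrow> real"
  assumes f1: "\<And>t. t \<in> {0..1} \<Longrightarrow> (f has_real_derivative f' t) (at t within {0..1})"
    and f2: "\<And>t. t \<in> {0..1} \<Longrightarrow> (f' has_real_derivative f'' t) (at t within {0..1})"
    and nn: "\<And>t. t \<in> {0..1} \<Longrightarrow> 0 \<le> f'' t"
    and x: "x \<in> {0..1}" "f x = 0" "f' x = 0" and t: "t \<in> {0..1}"
  shows "0 \<le> f t"
proof -
  have cont: "continuous_on {0..1} f" "continuous_on {0..1} f'"
    using f1 f2 DERIV_continuous_on by blast+
  \<comment> \<open>At interior points the derivative relative to [0,1] is the ordinary one, which
    the monotonicity rule asks for.\<close>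
  have at: "at s within {0..1} = at s" if "0 < s" "s < 1" for s :: real
    using that by (intro at_within_interior) (simp add: interior_atLeastAtMost_real)
  have mono: "f' a \<le> f' b" if "0 \<le> a" "a \<le> b" "b \<le> 1" for a b
  proof (rule DERIV_nonneg_imp_increasing_open[OF that(2)])
    show "\<exists>y. (f' has_real_derivative y) (at s) \<and> 0 \<le> y" if "a < s" "s < b" for s
      using f2[of s] nn[of s] at[of s] that \<open>0 \<le> a\<close> \<open>b \<le> 1\<close> by auto
    show "continuous_on {a..b} f'" by (rule continuous_on_subset[OF cont(2)]) (use that in auto)
  qed
  show ?thesis
  proof (cases "x \<le> t")
    case True
    have "f x \<le> f t"
    proof (rule DERIV_nonneg_imp_increasing_open[OF True])
      show "\<exists>y. (f has_real_derivative y) (at s) \<and> 0 \<le> y" if "x < s" "s < t" for s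
        using f1[of s] mono[of x s] at[of s] that x t by auto
      show "continuous_on {x..t} f" by (rule continuous_on_subset[OF cont(1)]) (use x t in auto)
    qed
    then show ?thesis using x by simp
  next
    case False
    have "- f t \<le> - f x"
    proof (rule DERIV_nonneg_imp_increasing_open[of t x "\<lambda>s. - f s"])
      show "\<exists>y. ((\<lambda>s. - f s) has_real_derivative y) (at s) \<and> 0 \<le> y" if "t < s" "s < x" for s
        using DERIV_minus[of f "f' s" s UNIV] f1[of s] mono[of s x] at[of s] that x t
        by (intro exI[of _ "- f' s"]) auto
      show "continuous_on {t..x} (\<lambda>s. - f s)"
        by (rule continuous_on_minus, rule continuous_on_subset[OF cont(1)]) (use x t in auto)
    qed (use False in auto)
    then show ?thesis using x by simp
  qed
qed

text \<open>Let D be the expression on the left and E the bound on the right. Both vanish at x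
  together with their slopes, and |D''| <= E'', so E - D and E + D are convex with minimum 0 at
  x.\<close>

lemma taylor_remainder_bound:
  fixes y y' h :: "real \<Rightarrow> real"
  assumes y1: "\<And>t. t \<in> {0..1} \<Longrightarrow> (y has_real_derivative y' t) (at t within {0..1})"
    and y2: "\<And>t. t \<in> {0..1} \<Longrightarrow> (y' has_real_derivative - 2 * h t) (at t within {0..1})"
    and d: "0 < d" and x: "x \<in> {0..1}"
    and b: "\<And>u. u \<in> {0..1} \<Longrightarrow> \<bar>h u - h x - m * (u - x)\<bar> \<le> w * (2 + 4 * ((u - x) / d)\<^sup>2)"
    and t: "t \<in> {0..1}"
  shows "\<bar>y t - y x - y' x * (t - x) + h x * (t - x)\<^sup>2 + m / 3 * (t - x) ^ 3\<bar>
           \<le> w * (2 * (t - x)\<^sup>2 + 2 / 3 * (t - x) ^ 4 / d\<^sup>2)"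
proof -
  define D where "D t = y t - y x - y' x * (t - x) + h x * (t - x)\<^sup>2 + m / 3 * (t - x) ^ 3" for t
  define D' where "D' t = y' t - y' x + 2 * h x * (t - x) + m * (t - x)\<^sup>2" for t
  define D'' where "D'' t = - 2 * (h t - h x - m * (t - x))" for t
  define \<kappa> where "\<kappa> = w / d\<^sup>2"
  \<comment> \<open>Second antiderivative of \<open>E''\<close> from x; \<open>E''\<close> is twice
    the assumed bound on h minus its line, because y'' = -2 h.\<close>
  define E where "E t = 2 * w * (t - x)\<^sup>2 + 2 / 3 * \<kappa> * (t - x) ^ 4" for t
  define E' where "E' t = 4 * w * (t - x) + 8 / 3 * \<kappa> * (t - x) ^ 3" for t
  define E'' where "E'' t = 4 * w + 8 * \<kappa> * (t - x)\<^sup>2" for t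
  have D1: "(D has_real_derivative D' t) (at t within {0..1})" if "t \<in> {0..1}" for t
    unfolding D_def[abs_def] D'_def
    by (rule derivative_eq_intros y1 that refl)+ (simp add: power2_eq_square)
  have D2: "(D' has_real_derivative D'' t) (at t within {0..1})" if "t \<in> {0..1}" for t
    unfolding D'_def[abs_def] D''_def
    by (rule derivative_eq_intros y2 that refl)+ (simp add: algebra_simps)
  have E1: "(E has_real_derivative E' t) (at t within {0..1})" for t
    unfolding E_def[abs_def] E'_def
    by (rule derivative_eq_intros refl)+ (simp add: algebra_simps)
  have E2: "(E' has_real_derivative E'' t) (at t within {0..1})" for t
    unfolding E'_def[abs_def] E''_def
    by (rule derivative_eq_intros refl)+ (simp add: algebra_simps)
  have bd: "\<bar>D'' s\<bar> \<le> E'' s" if "s \<in> {0..1}" for s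
  proof -
    have "\<bar>D'' s\<bar> = 2 * \<bar>h s - h x - m * (s - x)\<bar>"
      unfolding D''_def abs_mult by simp
    also have "\<dots> \<le> 2 * (w * (2 + 4 * ((s - x) / d)\<^sup>2))"
      using b[OF that] by simp
    also have "\<dots> = E'' s"
      by (simp add: E''_def \<kappa>_def power_divide algebra_simps)
    finally show ?thesis .
  qed
  have at_x: "D x = 0" "D' x = 0" "E x = 0" "E' x = 0"
    by (simp_all add: D_def D'_def E_def E'_def)
  have "0 \<le> E t - D t"
  proof (rule nonneg_of_second_derivative_nonneg[where f = "\<lambda>t. E t - D t"
        and f' = "\<lambda>t. E' t - D' t" and f'' = "\<lambda>t. E'' t - D'' t" and x = x])
    show "((\<lambda>t. E t - D t) has_real_derivative E' s - D' s) (at s within {0..1})"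
      "((\<lambda>t. E' t - D' t) has_real_derivative E'' s - D'' s) (at s within {0..1})"
      "0 \<le> E'' s - D'' s" if "s \<in> {0..1}" for s
      using DERIV_diff[OF E1 D1[OF that]] DERIV_diff[OF E2 D2[OF that]] bd[OF that] by simp_all
  qed (use x t at_x in auto)
  moreover have "0 \<le> E t + D t"
  proof (rule nonneg_of_second_derivative_nonneg[where f = "\<lambda>t. E t + D t"
        and f' = "\<lambda>t. E' t + D' t" and f'' = "\<lambda>t. E'' t + D'' t" and x = x])
    show "((\<lambda>t. E t + D t) has_real_derivative E' s + D' s) (at s within {0..1})"
      "((\<lambda>t. E' t + D' t) has_real_derivative E'' s + D'' s) (at s within {0..1})"
      "0 \<le> E'' s + D'' s" if "s \<in> {0..1}" for s
      using DERIV_add[OF E1 D1[OF that]] DERIV_add[OF E2 D2[OF that]] bd[OF that] by simp_all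
  qed (use x t at_x in auto)
  ultimately show ?thesis by (simp add: D_def E_def \<kappa>_def abs_le_iff algebra_simps)
qed

text \<open>Logarithmic differentiation of x^k (1 - x)^(n - k), multiplied through by
  \<open>Psi\<close> so that the identity also covers 0 and 1.\<close>

lemma DERIV_Bernstein:
  assumes "k \<le> n"
  shows "\<exists>D. (Bernstein n k has_real_derivative D) (at x) \<and> Psi x * D = (real k - real n * x) * Bernstein n k x"
proof -
  define D where "D = real (n choose k) * (real k * x ^ (k - 1) * (1 - x) ^ (n - k)
     - x ^ k * (real (n - k) * (1 - x) ^ (n - k - 1)))"
  have "(Bernstein n k has_real_derivative D) (at x)"
    unfolding Bernstein_def[abs_def] D_def
    by (rule derivative_eq_intros refl)+ (simp add: algebra_simps)
  moreover have "Psi x * D = (real k - real n * x) * Bernstein n k x"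
  proof -
    \<comment> \<open>The truncated exponents k - 1 and n - k - 1 do no harm at k = 0 and k = n,
      where their coefficients vanish.\<close>
    have 1: "real k * x ^ (k - 1) * x = real k * x ^ k"
      by (cases k) auto
    have 2: "real (n - k) * (1 - x) ^ (n - k - 1) * (1 - x) = real (n - k) * (1 - x) ^ (n - k)"
      by (cases "n - k") auto
    have "Psi x * D = real (n choose k) * ((1 - x) * (1 - x) ^ (n - k) * (real k * x ^ (k - 1) * x)
        - x * x ^ k * (real (n - k) * (1 - x) ^ (n - k - 1) * (1 - x)))"
      by (simp add: D_def Psi_def algebra_simps)
    also have "\<dots> = (real k * (1 - x) - real (n - k) * x) * Bernstein n k x"
      unfolding 1 2 by (simp add: Bernstein_def algebra_simps)
    also have "real k * (1 - x) - real (n - k) * x = real k - real n * x"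
      using assms by (simp add: of_nat_diff algebra_simps)
    finally show ?thesis .
  qed
  ultimately show ?thesis by blast
qed

text \<open>For x in [0,1], the m-th central moment of the binomial distribution. Deviations are
  counted as k - n x; \<open>central_moment_node\<close> rescales to k / n - x.\<close>

definition Bernstein_moment :: "nat \<Rightarrow> nat \<Rightarrow> real \<Rightarrow> real" where
  "Bernstein_moment n m x = (\<Sum>k\<le>n. (real k - real n * x) ^ m * Bernstein n k x)"

text \<open>Differentiating a moment and using \<open>\<Psi> p' = (k - n x) p\<close> produces the next one.\<close>

lemma Bernstein_moment_Suc:
  assumes "(Bernstein_moment n (Suc m) has_real_derivative D) (at x)"
  shows "Bernstein_moment n (Suc (Suc m)) x = Psi x * (D + real n * real (Suc m) * Bernstein_moment n m x)"
proof -
  obtain B' where B': "\<And>k. k \<le> n \<Longrightarrow> (Bernstein n k has_real_derivative B' k) (at x)"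
    "\<And>k. k \<le> n \<Longrightarrow> Psi x * B' k = (real k - real n * x) * Bernstein n k x"
    using DERIV_Bernstein[where n = n and x = x] by metis
  have "(Bernstein_moment n (Suc m) has_real_derivative
      (\<Sum>k\<le>n. real (Suc m) * (real k - real n * x) ^ m * (- real n) * Bernstein n k x
              + (real k - real n * x) ^ Suc m * B' k)) (at x)"
    unfolding Bernstein_moment_def[abs_def]
  proof (rule DERIV_sum)
    fix k assume "k \<in> {..n}"
    then have k: "k \<le> n" by simp
    have "((\<lambda>x. (real k - real n * x) ^ Suc m) has_real_derivative
        real (Suc m) * (real k - real n * x) ^ m * (- real n)) (at x)"
      by (rule derivative_eq_intros refl)+ simp
    from DERIV_mult[OF this B'(1)[OF k]]
    show "((\<lambda>x. (real k - real n * x) ^ Suc m * Bernstein n k x) has_real_derivative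
        real (Suc m) * (real k - real n * x) ^ m * (- real n) * Bernstein n k x
              + (real k - real n * x) ^ Suc m * B' k) (at x)"
      by (simp only: mult.commute)
  qed
  from DERIV_unique[OF assms this]
  have "Psi x * D = (\<Sum>k\<le>n. - (real n * real (Suc m) * Psi x * ((real k - real n * x) ^ m * Bernstein n k x))
              + (real k - real n * x) ^ Suc m * (Psi x * B' k))"
    by (simp add: sum_distrib_left algebra_simps)
  also have "\<dots> = (\<Sum>k\<le>n. - (real n * real (Suc m) * Psi x * ((real k - real n * x) ^ m * Bernstein n k x))
              + (real k - real n * x) ^ Suc (Suc m) * Bernstein n k x)"
  proof (rule sum.cong[OF refl])
    fix k assume "k \<in> {..n}"
    then have "(real k - real n * x) ^ Suc m * (Psi x * B' k) = (real k - real n * x) ^ Suc (Suc m) * Bernstein n k x"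
      using B'(2)[of k] by simp
    then show "- (real n * real (Suc m) * Psi x * ((real k - real n * x) ^ m * Bernstein n k x))
              + (real k - real n * x) ^ Suc m * (Psi x * B' k)
        = - (real n * real (Suc m) * Psi x * ((real k - real n * x) ^ m * Bernstein n k x))
              + (real k - real n * x) ^ Suc (Suc m) * Bernstein n k x"
      by (simp only:)
  qed
  also have "\<dots> = - (real n * real (Suc m) * Psi x * Bernstein_moment n m x) + Bernstein_moment n (Suc (Suc m)) x"
    unfolding sum.distrib sum_negf sum_distrib_left[symmetric] Bernstein_moment_def ..
  finally show ?thesis by (simp add: algebra_simps)
qed

text \<open>Moments 2, 3 and 4 follow from the recursion and the derivatives 0, n (1 - 2 x) and n (1
  - 6 Psi x) of moments 1, 2 and 3.\<close>

lemma Bernstein_moments: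
  "Bernstein_moment n 0 x = 1"
  "Bernstein_moment n 1 x = 0"
  "Bernstein_moment n 2 x = real n * Psi x"
  "Bernstein_moment n 3 x = real n * Psi x * (1 - 2 * x)"
  "Bernstein_moment n 4 x = real n * Psi x * (1 + 3 * (real n - 2) * Psi x)"
proof -
  show 0: "Bernstein_moment n 0 x = 1" for x by (simp add: Bernstein_moment_def)
  show 1: "Bernstein_moment n 1 x = 0" for x
    by (simp add: Bernstein_moment_def left_diff_distrib sum_subtractf sum_distrib_left[symmetric])
  have d1: "(Bernstein_moment n (Suc 0) has_real_derivative 0) (at x)" for x
  proof -
    have "Bernstein_moment n (Suc 0) = (\<lambda>x. 0)" using 1 by auto
    then show ?thesis by simp
  qed
  show 2: "Bernstein_moment n 2 x = real n * Psi x" for x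
    using Bernstein_moment_Suc[OF d1] 0 by (simp add: numeral_2_eq_2)
  have d2: "(Bernstein_moment n (Suc (Suc 0)) has_real_derivative real n * (1 - 2 * x)) (at x)" for x
  proof -
    have "Bernstein_moment n (Suc (Suc 0)) = (\<lambda>x. real n * Psi x)" using 2 by (auto simp: numeral_2_eq_2)
    then show ?thesis unfolding Psi_def by (auto intro!: derivative_eq_intros simp: algebra_simps)
  qed
  show 3: "Bernstein_moment n 3 x = real n * Psi x * (1 - 2 * x)" for x
    using Bernstein_moment_Suc[OF d2] 1 by (simp add: numeral_3_eq_3)
  have d3: "(Bernstein_moment n (Suc (Suc (Suc 0))) has_real_derivative real n * (1 - 6 * Psi x)) (at x)" for x
  proof -
    have "Bernstein_moment n (Suc (Suc (Suc 0))) = (\<lambda>x. real n * Psi x * (1 - 2 * x))"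
      using 3 by (auto simp: numeral_3_eq_3)
    then show ?thesis unfolding Psi_def by (auto intro!: derivative_eq_intros simp: algebra_simps)
  qed
  show "Bernstein_moment n 4 x = real n * Psi x * (1 + 3 * (real n - 2) * Psi x)"
    using Bernstein_moment_Suc[OF d3] 2 by (simp add: eval_nat_numeral algebra_simps)
qed

lemma central_moment_node:
  assumes "n \<ge> 1"
  shows "(\<Sum>k\<le>n. (real k / real n - x) ^ m * Bernstein n k x) = Bernstein_moment n m x / real n ^ m"
  unfolding Bernstein_moment_def sum_divide_distrib
proof (rule sum.cong[OF refl])
  fix k
  have "real k / real n - x = (real k - real n * x) / real n" using assms by (simp add: field_simps)
  then show "(real k / real n - x) ^ m * Bernstein n k x = (real k - real n * x) ^ m * Bernstein n k x / real n ^ m"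
    by (simp add: power_divide)
qed

text \<open>In the expansion of y at x, the value h(x) yields the main term -Psi h / n through the
  second moment, the slope m yields the third moment, and the remainder \<open>R\<close> is
  controlled by moments two and four.\<close>

lemma bernstein_voronovskaya_bound:
  fixes y y' h :: "real \<Rightarrow> real"
  assumes y1: "\<And>t. t \<in> {0..1} \<Longrightarrow> (y has_real_derivative y' t) (at t within {0..1})"
    and y2: "\<And>t. t \<in> {0..1} \<Longrightarrow> (y' has_real_derivative - 2 * h t) (at t within {0..1})"
    and h: "continuous_on {0..1} h" and n: "n \<ge> 4" and x: "x \<in> {0..1}"
  shows "\<bar>bernstein_op n y x - y x + Psi x * h x / real n\<bar>
    \<le> 3 * Psi x / real n * (1 / sqrt (real n) * modulus1 h (1 / sqrt (real n)) + modulus2 h (1 / sqrt (real n)))"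
proof -
  define d where "d = 1 / sqrt (real n)"
  define w1 where "w1 = modulus1 h d"
  define w2 where "w2 = modulus2 h d"
  have "sqrt 4 \<le> sqrt (real n)" using n by (intro real_sqrt_le_mono) simp
  then have sq: "2 \<le> sqrt (real n)" by simp
  \<comment> \<open>The bound d <= 1/2, required by \<open>local_slope\<close>, is n >= 4.\<close>
  have d: "0 < d" "d \<le> 1 / 2" using sq n by (auto simp: d_def field_simps)
  have d2: "d\<^sup>2 = 1 / real n" using n by (simp add: d_def power_divide)
  have w_nonneg: "0 \<le> w1" "0 \<le> w2"
    using modulus1_upper[OF h x x, of d] modulus2_upper[OF h order_refl, of d x] d x by (auto simp: w1_def w2_def)
  obtain m where m: "\<bar>m\<bar> \<le> w1 / d"
    and hm: "\<And>u. u \<in> {0..1} \<Longrightarrow> \<bar>h u - h x - m * (u - x)\<bar> \<le> w2 * (2 + 4 * ((u - x) / d)\<^sup>2)"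
    using local_slope[OF h d x] unfolding w1_def w2_def by blast
  define R where "R t = y t - y x - y' x * (t - x) + h x * (t - x)\<^sup>2 + m / 3 * (t - x) ^ 3" for t
  have R: "\<bar>R t\<bar> \<le> w2 * (2 * (t - x)\<^sup>2 + 2 / 3 * (t - x) ^ 4 / d\<^sup>2)" if "t \<in> {0..1}" for t
    unfolding R_def by (rule taylor_remainder_bound[OF y1 y2 d(1) x hm that])
  define N where "N k = real k / real n" for k
  have n1: "n \<ge> 1" using n by simp
  define M where "M j = (\<Sum>k\<le>n. (N k - x) ^ j * Bernstein n k x)" for j
  have M: "M j = Bernstein_moment n j x / real n ^ j" for j
    unfolding M_def N_def by (rule central_moment_node[OF n1])
  have M0: "M 0 = 1" and M1: "M 1 = 0" and M2: "M 2 = Psi x / real n"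
    and M3: "M 3 = Psi x * (1 - 2 * x) / (real n)\<^sup>2"
    and M4: "M 4 = Psi x * (1 + 3 * (real n - 2) * Psi x) / real n ^ 3"
    unfolding M Bernstein_moments using n by (simp_all add: eval_nat_numeral)
  have "bernstein_op n y x = (\<Sum>k\<le>n. (y x + y' x * (N k - x) - h x * (N k - x)\<^sup>2 - m / 3 * (N k - x) ^ 3 + R (N k))
      * Bernstein n k x)"
    unfolding bernstein_op_def atMost_atLeast0[symmetric] by (simp add: R_def N_def)
  also have "\<dots> = (\<Sum>k\<le>n. y x * ((N k - x) ^ 0 * Bernstein n k x) + y' x * ((N k - x) ^ 1 * Bernstein n k x)
      - h x * ((N k - x) ^ 2 * Bernstein n k x) - m / 3 * ((N k - x) ^ 3 * Bernstein n k x)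
      + R (N k) * Bernstein n k x)"
    by (intro sum.cong refl) (simp add: algebra_simps)
  also have "\<dots> = y x * M 0 + y' x * M 1 - h x * M 2 - m / 3 * M 3 + (\<Sum>k\<le>n. R (N k) * Bernstein n k x)"
    unfolding sum.distrib sum_subtractf sum_distrib_left[symmetric] M_def ..
  finally have split: "bernstein_op n y x - y x + Psi x * h x / real n
      = (\<Sum>k\<le>n. R (N k) * Bernstein n k x) - m / 3 * M 3"
    by (simp only: M0 M1 M2) (simp add: algebra_simps)
  have "\<bar>\<Sum>k\<le>n. R (N k) * Bernstein n k x\<bar> \<le> (\<Sum>k\<le>n. \<bar>R (N k) * Bernstein n k x\<bar>)"
    by (rule sum_abs)
  also have "\<dots> \<le> (\<Sum>k\<le>n. w2 * (2 * (N k - x)\<^sup>2 + 2 / 3 * (N k - x) ^ 4 / d\<^sup>2) * Bernstein n k x)"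
  proof (rule sum_mono)
    fix k assume "k \<in> {..n}"
    then have "N k \<in> {0..1}" using n by (simp add: N_def)
    then show "\<bar>R (N k) * Bernstein n k x\<bar> \<le> w2 * (2 * (N k - x)\<^sup>2 + 2 / 3 * (N k - x) ^ 4 / d\<^sup>2) * Bernstein n k x"
      unfolding abs_mult using R[of "N k"] Bernstein_nonneg[of x] x by (simp add: mult_right_mono)
  qed
  also have "\<dots> = (\<Sum>k\<le>n. (2 * w2) * ((N k - x)\<^sup>2 * Bernstein n k x) + (2 / 3 * w2 * real n) * ((N k - x) ^ 4 * Bernstein n k x))"
    unfolding d2 by (intro sum.cong refl) (simp add: algebra_simps)
  also have "\<dots> = (2 * w2) * M 2 + (2 / 3 * w2 * real n) * M 4"
    unfolding sum.distrib sum_distrib_left[symmetric] M_def ..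
  also have "\<dots> \<le> (2 * w2) * (Psi x / real n) + (2 / 3 * w2 * real n) * (3 / 4 * (Psi x / (real n)\<^sup>2))"
  proof (intro add_mono mult_left_mono)
    show "M 2 \<le> Psi x / real n" by (simp add: M2)
    \<comment> \<open>Since Psi <= 1/4, the bracket of the fourth moment is at most (3 n - 2) / 4 <=
      (3/4) n, and one power of n cancels.\<close>
    have "3 * (real n - 2) * Psi x \<le> 3 * (real n - 2) * (1 / 4)"
      using Psi_le_quarter n by (intro mult_left_mono) auto
    then have "1 + 3 * (real n - 2) * Psi x \<le> 3 / 4 * real n" by simp
    then have "Psi x * (1 + 3 * (real n - 2) * Psi x) / real n ^ 3 \<le> Psi x * (3 / 4 * real n) / real n ^ 3"
      using Psi_nonneg[OF x] by (intro divide_right_mono mult_left_mono) auto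
    then show "M 4 \<le> 3 / 4 * (Psi x / (real n)\<^sup>2)"
      unfolding M4 using n by (simp add: eval_nat_numeral)
  qed (use w_nonneg in auto)
  also have "\<dots> = 5 / 2 * w2 * (Psi x / real n)"
    using n by (simp add: power2_eq_square)
  finally have A: "\<bar>\<Sum>k\<le>n. R (N k) * Bernstein n k x\<bar> \<le> 5 / 2 * w2 * (Psi x / real n)" .
  have "\<bar>m / 3 * M 3\<bar> = 1 / 3 * \<bar>m\<bar> * (Psi x * \<bar>1 - 2 * x\<bar> / (real n)\<^sup>2)"
    using Psi_nonneg[OF x] by (simp add: M3 abs_mult)
  also have "\<dots> \<le> 1 / 3 * (w1 / d) * (Psi x * 1 / (real n)\<^sup>2)"
    using m x Psi_nonneg[OF x] w_nonneg d
    by (intro mult_mono divide_right_mono order_refl) (auto intro!: divide_nonneg_nonneg mult_nonneg_nonneg)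
  also have "\<dots> = 1 / 3 * (d * w1) * (Psi x / real n)"
  proof -
    have "w1 / d = real n * (d * w1)" using d2 d n by (simp add: field_simps power2_eq_square)
    then show ?thesis using n by (simp add: power2_eq_square)
  qed
  finally have B: "\<bar>m / 3 * M 3\<bar> \<le> 1 / 3 * (d * w1) * (Psi x / real n)" .
  have p: "0 \<le> Psi x / real n" using Psi_nonneg[OF x] by simp
  have "\<bar>bernstein_op n y x - y x + Psi x * h x / real n\<bar> \<le> (1 / 3 * (d * w1) + 5 / 2 * w2) * (Psi x / real n)"
    unfolding split distrib_right using A B by linarith
  also have "\<dots> \<le> (3 * (d * w1) + 3 * w2) * (Psi x / real n)"
    using w_nonneg d by (intro mult_right_mono p add_mono mult_right_mono) auto
  also have "\<dots> = 3 * Psi x / real n * (d * w1 + w2)" by (simp add: algebra_simps add_divide_distrib)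
  finally show ?thesis by (simp add: d_def w1_def w2_def)
qed

section \<open>The estimate for the limiting operator\<close>

lemma A_series_inf_bound:
  assumes h: "continuous_on {0..1} h" and n: "n \<ge> 4" and x: "x \<in> {0..1}"
  shows "\<bar>A_series_inf n (\<lambda>t. Psi t * h t) x - 2 * F_inf h x\<bar>
    \<le> 3 * Psi x * (1 / sqrt (real n) * modulus1 h (1 / sqrt (real n)) + modulus2 h (1 / sqrt (real n)))"
proof -
  define K where "K = 1 / sqrt (real n) * modulus1 h (1 / sqrt (real n)) + modulus2 h (1 / sqrt (real n))"
  define f where "f t = Psi t * h t" for t
  have f: "f \<in> C0" by (rule C0I[OF h]) (simp add: f_def)
  have n1: "n \<ge> 1" using n by simp
  note B = Psi_contraction_bernstein_op[OF n1]
  define G where "G = power_series_op (bernstein_op n) f"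
  have G: "G \<in> C0" unfolding G_def by (rule power_series_op_C0[OF B f])
  have Gfix: "G t = f t + bernstein_op n G t" if "t \<in> {0..1}" for t
    unfolding G_def by (rule power_series_op_fixpoint[OF B f that])
  define y where "y t = 2 * F_inf h t" for t
  define y' where "y' x = 2 * (integral {x..1} (\<lambda>t. (1 - t) * h t) - integral {0..x} (\<lambda>t. t * h t))" for x
  have y1: "(y has_real_derivative y' t) (at t within {0..1})" if "t \<in> {0..1}" for t
    unfolding y_def[abs_def] y'_def by (rule DERIV_cmult[OF F_inf_derivatives(1)[OF h that]])
  have y2: "(y' has_real_derivative - 2 * h t) (at t within {0..1})" if "t \<in> {0..1}" for t
    using DERIV_cmult[OF F_inf_derivatives(2)[OF h that], of 2] unfolding y'_def[abs_def] by simp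
  define e where "e t = G t / real n - y t" for t
  have lin: "bernstein_op n e t = bernstein_op n G t / real n - bernstein_op n y t" for t
    by (simp add: bernstein_op_def e_def left_diff_distrib sum_subtractf sum_divide_distrib)
  have e0: "e 0 = 0" "e 1 = 0" using C0_endpoints[OF G] F_inf_endpoints by (auto simp: e_def y_def)
  obtain C where C: "\<forall>t\<in>{0..1}. \<bar>F_inf h t\<bar> \<le> C * Psi t" using F_inf_bound[OF h] by blast
  \<comment> \<open>The denominator equals 1 / n, so the loss n of the residual argument exactly
    cancels the 1 / n of the Voronovskaya bound.\<close>
  have "\<bar>e x\<bar> \<le> (3 * K / real n) / (1 - (1 - 1 / real n)) * Psi x"
  proof (rule Psi_residual_bound[where Td = "bernstein_op n e" and C = "norm0 G / real n + 2 * C"])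
    show "0 \<le> 1 - 1 / real n" "1 - 1 / real n < 1" using n by auto
    fix t :: real assume t: "t \<in> {0..1}"
    have "\<bar>G t / real n\<bar> \<le> norm0 G * Psi t / real n"
      using norm0_bounds(2)[OF G t] by (simp add: divide_right_mono)
    moreover have "\<bar>y t\<bar> \<le> 2 * C * Psi t" using bspec[OF C t] by (simp add: y_def abs_mult)
    moreover have "(norm0 G / real n + 2 * C) * Psi t = norm0 G * Psi t / real n + 2 * C * Psi t"
      by (simp add: distrib_right)
    ultimately show "\<bar>e t\<bar> \<le> (norm0 G / real n + 2 * C) * Psi t"
      unfolding e_def by linarith
    have "e t - bernstein_op n e t = bernstein_op n y t - y t + Psi t * h t / real n"
      using Gfix[OF t] by (simp add: lin e_def f_def add_divide_distrib)
    then show "\<bar>e t - bernstein_op n e t\<bar> \<le> 3 * K / real n * Psi t"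
      using bernstein_voronovskaya_bound[OF y1 y2 h n t] by (simp add: K_def mult_ac)
  next
    \<comment> \<open>Membership of \<open>e\<close> in \<open>C0\<close> has not been established,
      so the contraction bound is verified directly from the values at the nodes.\<close>
    fix c assume c: "\<forall>t\<in>{0..1}. \<bar>e t\<bar> \<le> c * Psi t"
    show "\<forall>t\<in>{0..1}. \<bar>bernstein_op n e t\<bar> \<le> (1 - 1 / real n) * c * Psi t"
    proof
      fix t :: real assume t: "t \<in> {0..1}"
      have "\<bar>bernstein_op n e t\<bar> \<le> (\<Sum>k=1..n-1. \<bar>e (real k / real n) * Bernstein n k t\<bar>)"
        unfolding bernstein_op_interior[of e, OF e0 n1] by (rule sum_abs)
      also have "\<dots> \<le> (\<Sum>k=1..n-1. c * Psi (real k / real n) * Bernstein n k t)"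
      proof (rule sum_mono)
        fix k assume "k \<in> {1..n-1}"
        from bspec[OF c node_in_unit[OF this]]
        show "\<bar>e (real k / real n) * Bernstein n k t\<bar> \<le> c * Psi (real k / real n) * Bernstein n k t"
          using Bernstein_nonneg[of t n k] t by (simp add: abs_mult mult_right_mono)
      qed
      also have "\<dots> = c * ((1 - 1 / real n) * Psi t)"
        unfolding sum_Psi_Bernstein_interior[OF n1, symmetric] by (simp add: sum_distrib_left mult_ac)
      finally show "\<bar>bernstein_op n e t\<bar> \<le> (1 - 1 / real n) * c * Psi t" by (simp add: mult_ac)
    qed
  qed (rule x)
  then have "\<bar>e x\<bar> \<le> 3 * Psi x * K" using n by (simp add: mult_ac)
  then show ?thesis by (simp add: e_def y_def K_def A_series_inf_def G_def f_def[abs_def])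
qed

theorem mainTheorem3:
  fixes h :: "real \<Rightarrow> real" and x :: real and n :: nat
  assumes "continuous_on {0..1} h"
    and "x \<in> {0..1}"
    and "n \<ge> 10"
  shows "((\<lambda>\<rho>::real. \<bar>A_series n \<rho> (\<lambda>t. Psi t * h t) x - (- A_diff_inv \<rho> (\<lambda>t. Psi t * h t) x)\<bar>)
            \<longlongrightarrow> \<bar>A_series_inf n (\<lambda>t. Psi t * h t) x - (- A_diff_inv_inf (\<lambda>t. Psi t * h t) x)\<bar>) at_top
       \<and> \<bar>A_series_inf n (\<lambda>t. Psi t * h t) x - (- A_diff_inv_inf (\<lambda>t. Psi t * h t) x)\<bar>
            \<le> 3 * Psi x * (1 / sqrt (real n) * modulus1 h (1 / sqrt (real n))
                            + modulus2 h (1 / sqrt (real n)))"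
proof
  let ?f = "\<lambda>t. Psi t * h t"
  have f: "?f \<in> C0" by (rule C0I[OF assms(1)]) simp
  have n: "n \<ge> 1" "n \<ge> 4" "real n > 0" using assms(3) by auto
  have lim: "((\<lambda>\<rho>::real. \<rho> / (real n * \<rho> + 1)) \<longlongrightarrow> 1 / real n) at_top"
    using n(3) unfolding divide_inverse[of 1] mult_1 by real_asymp
  have lim2: "((\<lambda>\<rho>::real. 2 * \<rho> / (\<rho> + 1)) \<longlongrightarrow> 2) at_top"
    by real_asymp
  have A: "((\<lambda>\<rho>. A_series n \<rho> ?f x) \<longlongrightarrow> A_series_inf n ?f x) at_top"
    unfolding A_series_def A_series_inf_def
    by (intro tendsto_mult lim power_series_U_op_tendsto f assms(2) n)
  have "((\<lambda>\<rho>. - (2 * \<rho> / (\<rho> + 1)) * F_inf h x) \<longlongrightarrow> - 2 * F_inf h x) at_top"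
    by (intro tendsto_mult tendsto_minus lim2 tendsto_const)
  \<comment> \<open>The closed form of \<open>A_diff_inv\<close> is available for \<rho> > 0, hence
    eventually.\<close>
  then have "((\<lambda>\<rho>. A_diff_inv \<rho> ?f x) \<longlongrightarrow> - 2 * F_inf h x) at_top"
    by (rule Lim_transform_eventually)
      (auto intro!: eventually_mono[OF eventually_gt_at_top[of "0::real"]]
        simp: A_diff_inv_Psi_mult[OF assms(1) _ assms(2)])
  then have D: "((\<lambda>\<rho>. A_diff_inv \<rho> ?f x) \<longlongrightarrow> A_diff_inv_inf ?f x) at_top"
    by (simp add: A_diff_inv_inf_Psi_mult[OF assms(1,2)])
  show "((\<lambda>\<rho>::real. \<bar>A_series n \<rho> ?f x - (- A_diff_inv \<rho> ?f x)\<bar>)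
            \<longlongrightarrow> \<bar>A_series_inf n ?f x - (- A_diff_inv_inf ?f x)\<bar>) at_top"
    by (intro tendsto_rabs tendsto_diff tendsto_minus A D)
  show "\<bar>A_series_inf n ?f x - (- A_diff_inv_inf ?f x)\<bar>
      \<le> 3 * Psi x * (1 / sqrt (real n) * modulus1 h (1 / sqrt (real n)) + modulus2 h (1 / sqrt (real n)))"
    using A_series_inf_bound[OF assms(1) n(2) assms(2)] by (simp add: A_diff_inv_inf_Psi_mult[OF assms(1,2)])
qed

end
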